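(* Let $n\ge1$ and, for $s\in(0,1)$ and $p\in(1,\infty)$, let $$C_1(n,s,p)=\frac{\frac{sp}{2}(1-s)2^{2s-1}}{\pi^{\frac{n-1}{2}}}\,\frac{\Gamma\left(\frac{n+sp}{2}\right)}{\Gamma\left(\frac{p+1}{2}\right)\Gamma(2-s)},$$ and define $(-\Delta)_p^s$ with this constant, i.e. $$(-\Delta)_p^s \phi(x)=C_1(n,s,p)\,\mathrm{P.V.}\int_{\mathbb R^n}\frac{\Phi_p(\phi(x)-\phi(y))}{|x-y|^{n+sp}}\,dy .$$ Then for every $\phi\in C^2_b(\mathbb R^n)$ and every $x\in\mathbb R^n$: $$(-\Delta)_p^s\phi(x)\longrightarrow-\Delta_p\phi(x)\quad\text{as } s\to1^-,\qquad\text{for all } p\in[2,\infty),$$ and $$(-\Delta)_p^s\phi(x)\longrightarrow(-\Delta)^s\phi(x)\quad\text{as } p\to2^+,\qquad\text{for all } s\in(0,1).$$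
   Context: $C^2_b(\mathbb R^n)$ is the space of $C^2$ functions $\mathbb R^n\to\mathbb R$ that are bounded together with their derivatives up to order two. $\Phi_p(t)=|t|^{p-2}t$ (with $\Phi_p(0)=0$). $\mathrm{P.V.}\int_{\mathbb R^n}=\lim_{\varepsilon\to0^+}\int_{|x-y|>\varepsilon}$. The $p$-Laplacian is $\Delta_p\phi=\mathrm{div}(|\nabla\phi|^{p-2}\nabla\phi)$, which for $p>2$ equals $0$ at points where $\nabla\phi=0$. The fractional Laplacian is $$(-\Delta)^s\phi(x)=c_{n,s}\,\mathrm{P.V.}\int_{\mathbb R^n}\frac{\phi(x)-\phi(y)}{|x-y|^{n+2s}}\,dy,\qquad c_{n,s}=\frac{2^{2s}\Gamma\left(\frac{n+2s}{2}\right)}{\pi^{\frac n2}|\Gamma(-s)|}=s(1-s)\frac{2^{2s}\Gamma\left(\frac{n+2s}{2}\right)}{\pi^{\frac n2}\Gamma(2-s)} .$$ *)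

theory Defs
  imports "HOL-Analysis.Analysis"
begin

text \<open>The space \<open>\<real>\<^sup>n\<close> is rendered as the type \<^typ>\<open>real^'n\<close>, so that \<open>n = CARD('n)\<close>.\<close>

text \<open>Bounded \<open>C\<^sup>2\<close> functions: \<open>G\<close> is the gradient field and \<open>H\<close> the Hessian matrix field of \<open>\<phi>\<close>;
  both are uniquely determined by \<open>\<phi>\<close>. Continuity of \<open>\<phi>\<close> and \<open>G\<close> follows from differentiability.\<close>
definition C2b :: "(real^'n \<Rightarrow> real) set" where
  "C2b = {\<phi>. \<exists>(G :: real^'n \<Rightarrow> real^'n) (H :: real^'n \<Rightarrow> real^'n^'n).
      (\<forall>x. GDERIV \<phi> x :> G x) \<and>
      (\<forall>x. (G has_derivative (\<lambda>h. H x *v h)) (at x)) \<and>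
      continuous_on UNIV H \<and>
      bounded (range \<phi>) \<and> bounded (range G) \<and> bounded (range H)}"

text \<open>The convention \<open>0 powr a = 0\<close> gives \<open>\<Phi>\<^sub>p(0) = 0\<close> for every \<open>p\<close>.\<close>
definition Phi :: "real \<Rightarrow> real \<Rightarrow> real" where
  "Phi p t = \<bar>t\<bar> powr (p - 2) * t"

text \<open>Principal value at \<open>x\<close> of an integral over the whole space.\<close>
definition PV :: "real^'n \<Rightarrow> (real^'n \<Rightarrow> real) \<Rightarrow> real" where
  "PV x f = Lim (at_right 0) (\<lambda>\<epsilon>. LINT y:{y. norm (x - y) > \<epsilon>}|lborel. f y)"

definition grad :: "(real^'n \<Rightarrow> real) \<Rightarrow> real^'n \<Rightarrow> real^'n" where
  "grad \<phi> x = (THE D. GDERIV \<phi> x :> D)"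

definition divergence :: "(real^'n \<Rightarrow> real^'n) \<Rightarrow> real^'n \<Rightarrow> real" where
  "divergence F x = trace (jacobian F (at x))"

text \<open>At \<open>p = 2\<close> the convention \<open>0 powr 0 = 0\<close> is harmless, since the factor multiplies a
  vanishing gradient.\<close>
definition p_laplacian :: "real \<Rightarrow> (real^'n \<Rightarrow> real) \<Rightarrow> real^'n \<Rightarrow> real" where
  "p_laplacian p \<phi> = divergence (\<lambda>y. (norm (grad \<phi> y) powr (p - 2)) *\<^sub>R grad \<phi> y)"

definition c_frac :: "nat \<Rightarrow> real \<Rightarrow> real" where
  "c_frac n s = 2 powr (2 * s) * Gamma ((real n + 2 * s) / 2)
      / (pi powr (real n / 2) * \<bar>Gamma (- s)\<bar>)"

definition frac_laplacian :: "real \<Rightarrow> (real^'n \<Rightarrow> real) \<Rightarrow> real^'n \<Rightarrow> real" where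
  "frac_laplacian s \<phi> x = c_frac CARD('n) s
      * PV x (\<lambda>y. (\<phi> x - \<phi> y) / norm (x - y) powr (real CARD('n) + 2 * s))"

definition C1 :: "nat \<Rightarrow> real \<Rightarrow> real \<Rightarrow> real" where
  "C1 n s p = ((s * p / 2) * (1 - s) * 2 powr (2 * s - 1)) / pi powr ((real n - 1) / 2)
      * (Gamma ((real n + s * p) / 2) / (Gamma ((p + 1) / 2) * Gamma (2 - s)))"

definition frac_p_laplacian :: "real \<Rightarrow> real \<Rightarrow> (real^'n \<Rightarrow> real) \<Rightarrow> real^'n \<Rightarrow> real" where
  "frac_p_laplacian s p \<phi> x = C1 CARD('n) s p
      * PV x (\<lambda>y. Phi p (\<phi> x - \<phi> y) / norm (x - y) powr (real CARD('n) + s * p))"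

lemma c_frac_alt:
  assumes "0 < s" "s < 1"
  shows "c_frac n s = s * (1 - s) * (2 powr (2 * s) * Gamma ((real n + 2 * s) / 2))
      / (pi powr (real n / 2) * Gamma (2 - s))"
proof -
  have ni: "- s \<notin> \<int>\<^sub>\<le>\<^sub>0"
  proof
    assume "- s \<in> \<int>\<^sub>\<le>\<^sub>0"
    then obtain k :: int where "- s = of_int k"
      by (auto elim!: nonpos_Ints_cases)
    then have "- 1 < (of_int k :: real)" "(of_int k :: real) < 0"
      using assms by linarith+
    then have "- 1 < k" "k < 0"
      by simp_all
    then show False
      by simp
  qed
  have "Gamma (1 - s) = (- s) * Gamma (- s)"
    using Gamma_plus1[OF ni] by (simp add: add.commute)
  moreover have "Gamma (2 - s) = (1 - s) * Gamma (1 - s)"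
    using Gamma_plus1[of "1 - s"] assms by (fastforce simp: algebra_simps dest: nonpos_Ints_nonpos)
  moreover have "Gamma (- s) < 0"
  proof -
    have "Gamma (1 - s) > 0"
      using assms by simp
    with \<open>Gamma (1 - s) = (- s) * Gamma (- s)\<close> show ?thesis
      using assms by (simp add: mult_less_0_iff)
  qed
  ultimately have "Gamma (2 - s) = s * (1 - s) * \<bar>Gamma (- s)\<bar>"
    by simp
  then have "\<bar>Gamma (- s)\<bar> = Gamma (2 - s) / (s * (1 - s))"
    using assms by simp
  then show ?thesis
    by (simp add: c_frac_def)
qed

end

theory Submission
  imports Defs
begin

text \<open>Symmetrizing \<open>z \<mapsto> -z\<close> turns the principal value into an absolutely convergent integral of
  \<open>S\<^sub>p(z) / |z|\<^bsup>n+sp\<^esup>\<close>, where \<open>S\<^sub>p(z)\<close> averages \<open>\<Phi>\<^sub>p(\<phi>(x) - \<phi>(x \<plusminus> z))\<close> and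
  \<open>|S\<^sub>p(z)| \<le> M min(1, |z|\<^bsup>p\<^esup>)\<close> by the \<open>C\<^sup>2\<close> bounds. For \<open>p \<rightarrow> 2\<close> dominated convergence suffices.
  For \<open>s \<rightarrow> 1\<close> write \<open>\<Gamma>(a) |z|\<^bsup>-2a\<^esup> = \<integral> t\<^bsup>a-1\<^esup> exp(-t|z|\<^sup>2) dt\<close> with \<open>a = (n+sp)/2\<close>; Fubini and the dilation
  \<open>z = w/\<surd>t\<close> reduce the integral to \<open>\<integral> t\<^bsup>sp/2-1\<^esup> m(t) dt\<close>, where \<open>m(t)\<close> is the Gaussian integral of
  \<open>S\<^sub>p(w/\<surd>t)\<close>. The factor \<open>1 - s\<close> extracts the limit of \<open>t\<^bsup>p/2\<^esup> m(t)\<close> at infinity, which is a Gaussian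
  moment of the second-order Taylor term \<open>|\<nabla>\<phi>\<cdot>w|\<^bsup>p-2\<^esup> w\<cdot>Hw\<close> of \<open>S\<^sub>p\<close>. A rotation carrying a coordinate
  axis to the direction of \<open>\<nabla>\<phi>\<close> splits this moment into one-dimensional Gamma integrals.\<close>

section \<open>Lebesgue measure: rotations, products, dilations\<close>

lemma nn_integral_lborel_translation:
  fixes c :: "'a::euclidean_space"
  assumes [measurable]: "g \<in> borel_measurable borel"
  shows "(\<integral>\<^sup>+x. g (x + c) \<partial>lborel) = (\<integral>\<^sup>+x. g x \<partial>lborel)"
proof -
  have "(\<integral>\<^sup>+x. g x \<partial>lborel) = (\<integral>\<^sup>+x. g x \<partial>(distr lborel borel ((+) c)))"
    by (simp add: lborel_distr_plus)
  also have "\<dots> = (\<integral>\<^sup>+x. g (c + x) \<partial>lborel)"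
    by (subst nn_integral_distr) auto
  finally show ?thesis by (simp add: add.commute)
qed

text \<open>The library result \<open>measure_orthogonal_image\<close> covers only \<open>real^'n\<close> with a well-ordered index type. The proof
  is the uniqueness argument for Haar measure: integrate \<open>1\<^sub>B(y) 1\<^sub>A(f x + y)\<close> over \<open>x\<close> and \<open>y\<close>, with
  \<open>B\<close> the unit ball, in both orders.\<close>

lemma lborel_distr_orthogonal:
  fixes f :: "'a::euclidean_space \<Rightarrow> 'a"
  assumes f: "orthogonal_transformation f"
  shows "distr lborel borel f = lborel"
proof (rule measure_eqI)
  fix A assume "A \<in> sets (distr lborel borel f)"
  then have A [measurable]: "A \<in> sets borel" by simp
  define B where "B = ball (0::'a) 1"
  have [measurable]: "B \<in> sets borel" by (simp add: B_def)
  have lin: "linear f" using f by (rule orthogonal_transformation_linear)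
  have [measurable]: "f \<in> borel_measurable borel"
    by (intro borel_measurable_continuous_onI linear_continuous_on linear_conv_bounded_linear[THEN iffD1] lin)
  have surj: "f (inv f y) = y" for y
    by (meson f orthogonal_transformation_surj surj_f_inv_f)
  define v where "v = emeasure lborel B"
  have v: "v \<noteq> 0" "v \<noteq> top"
    by (simp_all add: v_def B_def emeasure_ball less_le order.strict_implies_not_eq[OF unit_ball_vol_pos, symmetric])
  have ball: "(\<integral>\<^sup>+x. indicator B (y - f x) \<partial>lborel) = v" for y
  proof -
    have "indicator B (y - f x) = (indicator (ball (inv f y) 1) x :: ennreal)" for x
    proof -
      have "y - f x = f (inv f y - x)" by (simp add: linear_diff[OF lin] surj)
      then have "norm (y - f x) = dist (inv f y) x"
        using orthogonal_transformation_norm[OF f] by (simp add: dist_norm)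
      then show ?thesis by (simp add: indicator_def B_def)
    qed
    then have "(\<integral>\<^sup>+x. indicator B (y - f x) \<partial>lborel) = emeasure lborel (ball (inv f y) 1)" by simp
    also have "\<dots> = v" by (simp add: v_def B_def emeasure_ball)
    finally show ?thesis .
  qed
  have distr_A: "emeasure (distr lborel borel f) A = (\<integral>\<^sup>+x. indicator A (f x) \<partial>lborel)"
  proof -
    have "emeasure (distr lborel borel f) A = (\<integral>\<^sup>+x. indicator A x \<partial>(distr lborel borel f))" by simp
    also have "\<dots> = (\<integral>\<^sup>+x. indicator A (f x) \<partial>lborel)"
      by (rule nn_integral_distr) measurable
    finally show ?thesis .
  qed
  have "v * emeasure (distr lborel borel f) A = (\<integral>\<^sup>+y. indicator B y * (\<integral>\<^sup>+x. indicator A (f x) \<partial>lborel) \<partial>lborel)"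
    by (simp add: v_def nn_integral_multc distr_A)
  also have "\<dots> = (\<integral>\<^sup>+y. (\<integral>\<^sup>+x. indicator B y * indicator A (f x + y) \<partial>lborel) \<partial>lborel)"
  proof (intro nn_integral_cong)
    fix y
    have "(\<integral>\<^sup>+x. indicator A (f x) \<partial>lborel) = (\<integral>\<^sup>+x. indicator A (f (x + inv f y)) \<partial>lborel)"
      by (rule nn_integral_lborel_translation[symmetric]) simp
    then show "indicator B y * (\<integral>\<^sup>+x. indicator A (f x) \<partial>lborel) = (\<integral>\<^sup>+x. indicator B y * indicator A (f x + y) \<partial>lborel)"
      by (simp add: nn_integral_cmult linear_add[OF lin] surj)
  qed
  also have "\<dots> = (\<integral>\<^sup>+x. (\<integral>\<^sup>+y. indicator B y * indicator A (f x + y) \<partial>lborel) \<partial>lborel)"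
    by (rule lborel_pair.Fubini') measurable
  also have "\<dots> = (\<integral>\<^sup>+x. (\<integral>\<^sup>+y. indicator B (y - f x) * indicator A y \<partial>lborel) \<partial>lborel)"
  proof (rule nn_integral_cong)
    fix x
    show "(\<integral>\<^sup>+y. indicator B y * indicator A (f x + y) \<partial>lborel)
        = (\<integral>\<^sup>+y. indicator B (y - f x) * indicator A y \<partial>lborel)"
      by (subst nn_integral_lborel_translation[of _ "f x", symmetric]) (auto simp: add.commute)
  qed
  also have "\<dots> = (\<integral>\<^sup>+y. (\<integral>\<^sup>+x. indicator B (y - f x) * indicator A y \<partial>lborel) \<partial>lborel)"
    by (rule lborel_pair.Fubini') measurable
  also have "\<dots> = v * emeasure lborel A"
    by (simp add: nn_integral_multc ball nn_integral_cmult)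
  finally show "emeasure (distr lborel borel f) A = emeasure lborel A"
    using v by (simp add: ennreal_mult_cancel_left)
qed simp

lemma integral_lborel_orthogonal:
  fixes f :: "'a::euclidean_space \<Rightarrow> 'a" and g :: "'a \<Rightarrow> real"
  assumes f: "orthogonal_transformation f" and [measurable]: "g \<in> borel_measurable borel"
  shows "(\<integral>x. g (f x) \<partial>lborel) = (\<integral>x. g x \<partial>lborel)"
proof -
  have "f \<in> borel_measurable borel"
    using orthogonal_transformation_linear[OF f]
    by (intro borel_measurable_continuous_onI linear_continuous_on linear_conv_bounded_linear[THEN iffD1])
  then show ?thesis
    by (subst (2) lborel_distr_orthogonal[OF f, symmetric]) (simp add: integral_distr)
qed

lemma prod_Basis_vec: "(\<Prod>b\<in>(Basis :: (real^'n) set). g b) = (\<Prod>i\<in>UNIV. g (axis i 1))"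
proof -
  have B: "Basis = (\<lambda>i. axis i (1::real) :: real^'n) ` UNIV"
    by (auto simp: Basis_vec_def)
  have I: "inj (\<lambda>i. axis i (1::real) :: real^'n)"
    by (auto simp: inj_on_def axis_eq_axis)
  show ?thesis unfolding B by (subst prod.reindex[OF I]) simp
qed

lemma
  fixes f :: "'n::finite \<Rightarrow> real \<Rightarrow> real"
  assumes int: "\<And>i. integrable lborel (f i)"
  shows integrable_lborel_prod: "integrable lborel (\<lambda>w::real^'n. \<Prod>i\<in>UNIV. f i (w $ i))"
    and integral_lborel_prod: "(\<integral>w. (\<Prod>i\<in>UNIV. f i ((w::real^'n) $ i)) \<partial>lborel) = (\<Prod>i\<in>UNIV. \<integral>u. f i u \<partial>lborel)"
proof -
  interpret product_sigma_finite "\<lambda>_::real^'n. lborel :: real measure" ..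
  define ix :: "real^'n \<Rightarrow> 'n" where "ix b = (SOME i. b = axis i 1)" for b
  have ix: "ix (axis i 1) = i" for i
    unfolding ix_def by (auto simp: axis_eq_axis)
  define T :: "(real^'n \<Rightarrow> real) \<Rightarrow> real^'n" where "T = (\<lambda>x. \<Sum>b\<in>Basis. x b *\<^sub>R b)"
  have T: "T x $ i = x (axis i 1)" for x i
  proof -
    have "T x \<bullet> axis i 1 = x (axis i 1)"
      unfolding T_def by (rule inner_sum_left_Basis) (simp add: axis_in_Basis_iff)
    then show ?thesis by (simp add: inner_axis)
  qed
  have [measurable]: "f i \<in> borel_measurable borel" for i
    using borel_measurable_integrable[OF int[of i]] by simp
  have eq: "(\<lambda>x. \<Prod>i\<in>UNIV. f i (T x $ i)) = (\<lambda>x. \<Prod>b\<in>(Basis :: (real^'n) set). f (ix b) (x b))"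
    by (simp add: T prod_Basis_vec ix)
  have mT: "T \<in> (\<Pi>\<^sub>M b\<in>Basis. lborel) \<rightarrow>\<^sub>M borel" unfolding T_def by measurable
  have mf: "(\<lambda>w::real^'n. \<Prod>i\<in>UNIV. f i (w $ i)) \<in> borel_measurable borel" by measurable
  have lb: "lborel = distr (\<Pi>\<^sub>M b\<in>Basis. lborel) borel T"
    unfolding T_def by (subst lborel_def) (simp add: lborel_eq_real)
  show "integrable lborel (\<lambda>w::real^'n. \<Prod>i\<in>UNIV. f i (w $ i))"
    unfolding lb integrable_distr_eq[OF mT mf] eq
    by (intro product_integrable_prod int finite_Basis)
  show "(\<integral>w. (\<Prod>i\<in>UNIV. f i ((w::real^'n) $ i)) \<partial>lborel) = (\<Prod>i\<in>UNIV. \<integral>u. f i u \<partial>lborel)"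
    unfolding lb integral_distr[OF mT mf] eq
    by (subst product_integral_prod) (auto intro: int simp: prod_Basis_vec ix)
qed

lemma
  fixes g :: "'a::euclidean_space \<Rightarrow> real"
  assumes c: "c > 0" and g: "g \<in> borel_measurable borel"
  shows integrable_lborel_scaleR: "integrable lborel (\<lambda>x. g (c *\<^sub>R x)) \<longleftrightarrow> integrable lborel g"
    and integral_lborel_scaleR: "(\<integral>x. g x \<partial>lborel) = c ^ DIM('a) * (\<integral>x. g (c *\<^sub>R x) \<partial>lborel)"
proof -
  have m: "(\<lambda>x::'a. 0 + c *\<^sub>R x) \<in> lborel \<rightarrow>\<^sub>M borel" by measurable
  have lb: "(lborel :: 'a measure) = density (distr lborel borel (\<lambda>x. 0 + c *\<^sub>R x)) (\<lambda>_. ennreal (c ^ DIM('a)))"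
    using lborel_affine[of c "0::'a"] c by simp
  note [measurable] = g
  show "integrable lborel (\<lambda>x. g (c *\<^sub>R x)) \<longleftrightarrow> integrable lborel g"
    using c by (subst (2) lb) (simp add: integrable_density integrable_distr_eq)
  show "(\<integral>x. g x \<partial>lborel) = c ^ DIM('a) * (\<integral>x. g (c *\<^sub>R x) \<partial>lborel)"
    using c by (subst lb) (simp add: integral_density integral_distr)
qed

lemma integral_dominated_convergence_within:
  fixes s :: "real \<Rightarrow> 'a \<Rightarrow> real"
  assumes f: "f \<in> borel_measurable M" and s: "\<And>t. s t \<in> borel_measurable M" and w: "integrable M w"
    and lim: "\<And>x. ((\<lambda>t. s t x) \<longlongrightarrow> f x) (at a within S)"
    and bound: "\<forall>\<^sub>F t in at a within S. \<forall>x. norm (s t x) \<le> w x"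
  shows "((\<lambda>t. \<integral>x. s t x \<partial>M) \<longlongrightarrow> (\<integral>x. f x \<partial>M)) (at a within S)"
proof -
  have "(\<lambda>n. \<integral>x. s (X n) x \<partial>M) \<longlonglongrightarrow> (\<integral>x. f x \<partial>M)"
    if X: "\<And>i. X i \<in> S - {a}" "X \<longlonglongrightarrow> a" for X
  proof -
    have flim: "filterlim X (at a within S) sequentially"
      using X by (auto simp: filterlim_at)
    obtain N where N: "\<And>n. n \<ge> N \<Longrightarrow> \<forall>x. norm (s (X n) x) \<le> w x"
      using eventually_compose_filterlim[OF bound flim] unfolding eventually_sequentially by blast
    show ?thesis
    proof (rule LIMSEQ_offset[of _ N], rule integral_dominated_convergence[OF f _ w])
      show "AE x in M. (\<lambda>n. s (X (n + N)) x) \<longlonglongrightarrow> f x"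
        by (intro AE_I2 LIMSEQ_ignore_initial_segment filterlim_compose[OF lim flim])
    qed (use s N in auto)
  qed
  then show ?thesis
    unfolding tendsto_at_iff_sequentially by (auto simp: o_def)
qed

section \<open>Gaussian moments\<close>

lemma has_bochner_integral_lborel_nonneg:
  fixes f :: "'a::euclidean_space \<Rightarrow> real"
  assumes [measurable]: "f \<in> borel_measurable borel" "S \<in> sets borel"
    and nn: "\<And>x. x \<in> S \<Longrightarrow> 0 \<le> f x" and I: "(f has_integral I) S"
  shows "has_bochner_integral lborel (\<lambda>x. indicator S x * f x) I"
proof (rule has_bochner_integral_nn_integral)
  show "0 \<le> I" using has_integral_nonneg[OF I nn] .
  show "(\<integral>\<^sup>+x. ennreal (indicator S x * f x) \<partial>lborel) = ennreal I"
    using nn_integral_has_integral_lebesgue[OF nn I] by (simp add: ennreal_indicator ennreal_mult'')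
qed (use nn in \<open>auto simp: indicator_def\<close>)

lemma has_bochner_integral_powr_exp_neg_square:
  fixes q :: real
  assumes q: "q > -1"
  shows "has_bochner_integral lborel (\<lambda>u::real. \<bar>u\<bar> powr q * exp (-(u^2))) (Gamma ((q+1)/2))"
proof -
  define x where "x = (q+1)/2"
  have x: "x > 0" using q by (simp add: x_def)
  define f where "f = (\<lambda>t::real. t powr (x - 1) / exp t)"
  have fi: "(f has_integral Gamma x) {0<..}"
    using Gamma_integral_real[OF x] unfolding f_def
    by (rule has_integral_spike_set_eq[THEN iffD1, rotated -1])
       (auto intro: negligible_subset[of "{0}"])
  have "f absolutely_integrable_on {0<..}"
    using fi by (intro nonnegative_absolutely_integrable_1) (auto simp: f_def integrable_on_def)
  moreover have img: "(\<lambda>u::real. u^2) ` {0<..} = {0<..}"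
  proof (intro equalityI subsetI)
    fix v :: real assume "v \<in> {0<..}"
    then have "v = (sqrt v)^2" "sqrt v \<in> {0<..}" by auto
    then show "v \<in> (\<lambda>u. u^2) ` {0<..}" by blast
  qed auto
  moreover have "inj_on (\<lambda>u::real. u^2) {0<..}"
    by (auto simp: inj_on_def power2_eq_iff)
  moreover have "((\<lambda>u::real. u^2) has_field_derivative 2 * u) (at u within {0<..})" for u
    by (auto intro!: derivative_eq_intros)
  ultimately have "(\<lambda>u. \<bar>2 * u\<bar> * f (u^2)) absolutely_integrable_on {0<..} \<and>
      integral {0<..} (\<lambda>u. \<bar>2 * u\<bar> * f (u^2)) = Gamma x"
    using fi by (subst has_absolute_integral_change_of_variables_1') auto
  then have "((\<lambda>u. \<bar>2 * u\<bar> * f (u^2)) has_integral Gamma x) {0<..}"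
    by (metis absolutely_integrable_on_def has_integral_integrable_integral)
  then have hi: "((\<lambda>u. 2 * (\<bar>u\<bar> powr q * exp (-(u^2)))) has_integral Gamma x) {0<..}"
  proof (rule has_integral_eq[rotated])
    fix u :: real assume "u \<in> {0<..}"
    then have u: "u > 0" by simp
    have "(u^2) powr (x - 1) = u powr (q - 1)"
    proof -
      have "(u^2) powr (x - 1) = u powr (2 * (x - 1))"
        using u by (simp add: powr_powr flip: powr_numeral)
      also have "2 * (x - 1) = q - 1" by (simp add: x_def field_simps)
      finally show ?thesis .
    qed
    moreover have "u * u powr (q - 1) = u powr q" using u by (simp add: powr_mult_base)
    ultimately show "\<bar>2 * u\<bar> * f (u^2) = 2 * (\<bar>u\<bar> powr q * exp (-(u^2)))"
      using u by (simp add: f_def exp_minus field_simps)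
  qed
  have "has_bochner_integral lborel (\<lambda>u. indicator {0<..} u * (2 * (\<bar>u\<bar> powr q * exp (-(u^2))))) (Gamma x)"
    by (rule has_bochner_integral_lborel_nonneg[OF _ _ _ hi]) auto
  then have "has_bochner_integral lborel (\<lambda>u. (1/2) * (indicator {0<..} u * (2 * (\<bar>u\<bar> powr q * exp (-(u^2)))))) ((1/2) * Gamma x)"
    by (rule has_bochner_integral_mult_right)
  then have "has_bochner_integral lborel (\<lambda>u. indicator {0..} u *\<^sub>R (\<bar>u\<bar> powr q * exp (-(u^2)))) ((1/2) * Gamma x)"
    by (rule has_bochner_integral_discrete_difference[where X="{0}", THEN iffD1, rotated -1])
       (auto split: split_indicator)
  from has_bochner_integral_even_function[OF this] show ?thesis by (simp add: x_def)
qed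

lemma has_bochner_integral_exp_neg_square:
  "has_bochner_integral lborel (\<lambda>u::real. exp (-(u^2))) (sqrt pi)"
proof -
  have "has_bochner_integral lborel (\<lambda>u::real. \<bar>u\<bar> powr 0 * exp (-(u^2))) (sqrt pi)"
    using has_bochner_integral_powr_exp_neg_square[of 0] by (simp add: Gamma_one_half_real)
  then show ?thesis
    by (rule has_bochner_integral_discrete_difference[where X="{0}", THEN iffD1, rotated -1])
       (auto split: split_indicator)
qed

text \<open>\<open>\<Phi>\<^sub>p\<close> has derivative \<open>(p - 1)\<close> times this weight. The case distinction makes it continuous
  for \<open>p = 2\<close>, where \<open>0 powr 0 = 0\<close>.\<close>

definition pweight :: "real \<Rightarrow> real \<Rightarrow> real" where
  "pweight p t = (if p = 2 then 1 else \<bar>t\<bar> powr (p - 2))"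

lemma pweight_nonneg: "0 \<le> pweight p t"
  by (simp add: pweight_def)

lemma pweight_mult: "pweight p (a * b) = pweight p a * pweight p b"
  by (simp add: pweight_def abs_mult powr_mult)

lemma continuous_on_pweight:
  assumes "p \<ge> 2"
  shows "continuous_on A (pweight p)"
proof (cases "p = 2")
  case False
  then have "p > 2" using assms by simp
  then have "continuous_on A (\<lambda>t. \<bar>t\<bar> powr (p - 2))"
    by (intro continuous_on_powr' continuous_intros) auto
  then show ?thesis using False by (simp add: pweight_def[abs_def])
qed (simp add: pweight_def[abs_def])

lemma borel_measurable_pweight [measurable]: "pweight p \<in> borel_measurable borel"
  unfolding pweight_def by measurable

text \<open>The powers \<open>u ^ 0\<close> and \<open>u ^ 1\<close> are kept so that the three cases match \<open>u ^ m\<close> below.\<close>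

lemma
  assumes p: "p \<ge> 2"
  shows has_bochner_integral_pweight_0:
      "has_bochner_integral lborel (\<lambda>u. pweight p u * u ^ 0 * exp (-(u^2))) (Gamma ((p - 1) / 2))"
    and has_bochner_integral_pweight_1:
      "has_bochner_integral lborel (\<lambda>u. pweight p u * u ^ 1 * exp (-(u^2))) 0"
    and has_bochner_integral_pweight_2:
      "has_bochner_integral lborel (\<lambda>u. pweight p u * u ^ 2 * exp (-(u^2))) ((p - 1) / 2 * Gamma ((p - 1) / 2))"
proof -
  have w: "pweight p u = \<bar>u\<bar> powr (p - 2)" if "u \<noteq> 0" for u
    using that by (simp add: pweight_def)
  have "has_bochner_integral lborel (\<lambda>u. \<bar>u\<bar> powr (p - 2) * exp (-(u^2))) (Gamma ((p - 1) / 2))"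
    using has_bochner_integral_powr_exp_neg_square[of "p - 2"] p by (simp add: add.commute)
  then show "has_bochner_integral lborel (\<lambda>u. pweight p u * u ^ 0 * exp (-(u^2))) (Gamma ((p - 1) / 2))"
    by (rule has_bochner_integral_discrete_difference[where X="{0}", THEN iffD1, rotated -1]) (auto simp: w)
  have "(p - 1) / 2 \<notin> \<int>\<^sub>\<le>\<^sub>0" using p by (auto dest: nonpos_Ints_nonpos)
  then have G: "Gamma ((p + 1) / 2) = (p - 1) / 2 * Gamma ((p - 1) / 2)"
    using Gamma_plus1[of "(p - 1) / 2"] by (simp add: field_simps)
  have "has_bochner_integral lborel (\<lambda>u. \<bar>u\<bar> powr p * exp (-(u^2))) ((p - 1) / 2 * Gamma ((p - 1) / 2))"
    using has_bochner_integral_powr_exp_neg_square[of p] p unfolding G by simp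
  moreover have "\<bar>u\<bar> powr p = \<bar>u\<bar> powr (p - 2) * u ^ 2" if "u \<noteq> 0" for u
    using that by (simp add: powr_diff)
  ultimately show "has_bochner_integral lborel (\<lambda>u. pweight p u * u ^ 2 * exp (-(u^2))) ((p - 1) / 2 * Gamma ((p - 1) / 2))"
    by (elim has_bochner_integral_discrete_difference[where X="{0}", THEN iffD1, rotated -1]) (auto simp: w)
  have "integrable lborel (\<lambda>u. \<bar>u\<bar> powr (p - 1) * exp (-(u^2)))"
    using has_bochner_integral_powr_exp_neg_square[of "p - 1"] p by (simp add: has_bochner_integral_iff)
  then have "integrable lborel (\<lambda>u. pweight p u * u ^ 1 * exp (-(u^2)))"
  proof (rule Bochner_Integration.integrable_bound)
    show "AE u in lborel. norm (pweight p u * u ^ 1 * exp (-(u^2))) \<le> norm (\<bar>u\<bar> powr (p - 1) * exp (-(u^2)))"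
    proof (rule AE_I2)
      fix u :: real
      have "\<bar>u\<bar> powr (p - 1) = \<bar>u\<bar> powr (p - 2) * \<bar>u\<bar>" if "u \<noteq> 0"
        using powr_add[of "\<bar>u\<bar>" "p - 2" 1] that by simp
      then show "norm (pweight p u * u ^ 1 * exp (-(u^2))) \<le> norm (\<bar>u\<bar> powr (p - 1) * exp (-(u^2)))"
        by (cases "u = 0") (simp_all add: w abs_mult)
    qed
  qed measurable
  then have "integrable lborel (\<lambda>u. indicator {0..} u *\<^sub>R (pweight p u * u ^ 1 * exp (-(u^2))))"
    by (intro integrable_mult_indicator) auto
  then show "has_bochner_integral lborel (\<lambda>u. pweight p u * u ^ 1 * exp (-(u^2))) 0"
    by (intro has_bochner_integral_odd_function[OF has_bochner_integral_integrable]) (auto simp: pweight_def)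
qed

lemma exp_neg_norm_square_prod:
  fixes w :: "real^'n"
  shows "exp (-((norm w)^2)) = (\<Prod>i\<in>UNIV. exp (-((w $ i)^2)))"
  by (simp add: power2_norm_eq_inner inner_vec_def flip: exp_sum sum_negf power2_eq_square)

lemma
  fixes i j k :: "'n::finite"
  assumes p: "p \<ge> 2"
  shows integrable_gaussian_moment:
      "integrable lborel (\<lambda>w::real^'n. exp (-((norm w)^2)) * pweight p (w $ k) * (w $ i * w $ j))" (is ?int)
    and integral_gaussian_moment:
      "(\<integral>w. exp (-((norm w)^2)) * pweight p ((w::real^'n) $ k) * (w $ i * w $ j) \<partial>lborel)
        = (if i = j then sqrt pi ^ CARD('n) * (Gamma ((p - 1) / 2) / sqrt pi) * (if i = k then (p - 1) / 2 else 1 / 2) else 0)"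
      (is ?eq)
proof -
  define P where "P l = (if l = k then p else 2)" for l
  define m where "m l = (of_bool (l = i) + of_bool (l = j) :: nat)" for l
  define F where "F l u = pweight (P l) u * u ^ m l * exp (-(u^2))" for l u
  have P: "P l \<ge> 2" for l using p by (simp add: P_def)
  have m: "m l = 0 \<or> m l = 1 \<or> m l = 2" for l by (simp add: m_def)
  have int: "integrable lborel (F l)" for l
    using m[of l] has_bochner_integral_pweight_0[OF P[of l]] has_bochner_integral_pweight_1[OF P[of l]]
      has_bochner_integral_pweight_2[OF P[of l]] unfolding F_def has_bochner_integral_iff by metis
  have prod_delta: "(\<Prod>l\<in>UNIV. if l = a then b l else 1) = b a" for a :: 'n and b :: "'n \<Rightarrow> real"
    by (simp add: prod.delta)
  have eq: "exp (-((norm w)^2)) * pweight p (w $ k) * (w $ i * w $ j) = (\<Prod>l\<in>UNIV. F l (w $ l))" for w :: "real^'n"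
  proof -
    have "F l (w $ l) = (if l = k then pweight p (w $ l) else 1) * (if l = i then w $ l else 1)
        * (if l = j then w $ l else 1) * exp (-((w $ l)^2))" for l
      by (simp add: F_def P_def m_def pweight_def)
    then show ?thesis
      by (simp add: prod.distrib prod_delta exp_neg_norm_square_prod)
  qed
  show ?int unfolding eq by (rule integrable_lborel_prod[OF int])
  have "(\<integral>w. exp (-((norm w)^2)) * pweight p ((w::real^'n) $ k) * (w $ i * w $ j) \<partial>lborel) = (\<Prod>l\<in>UNIV. \<integral>u. F l u \<partial>lborel)"
    unfolding eq by (rule integral_lborel_prod[OF int])
  also have "\<dots> = (if i = j then sqrt pi ^ CARD('n) * (Gamma ((p - 1) / 2) / sqrt pi) * (if i = k then (p - 1) / 2 else 1 / 2) else 0)"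
  proof (cases "i = j")
    case False
    then have "(\<integral>u. F i u \<partial>lborel) = 0"
      using has_bochner_integral_pweight_1[OF P[of i]] unfolding F_def m_def has_bochner_integral_iff by simp
    then have "(\<Prod>l\<in>UNIV. \<integral>u. F l u \<partial>lborel) = 0" by (intro prod_zero) auto
    then show ?thesis using False by simp
  next
    case True
    have "(\<integral>u. F l u \<partial>lborel) = sqrt pi * (if l = k then Gamma ((p - 1) / 2) / sqrt pi else 1)
        * (if l = i then (if l = k then (p - 1) / 2 else 1 / 2) else 1)" for l
      using True has_bochner_integral_pweight_0[OF P[of l]] has_bochner_integral_pweight_2[OF P[of l]]
      unfolding F_def m_def P_def has_bochner_integral_iff by (auto simp: Gamma_one_half_real power2_eq_square)
    then show ?thesis using True by (simp add: prod.distrib prod_delta)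
  qed
  finally show ?eq .
qed

lemma integrable_exp_neg_norm_square: "integrable lborel (\<lambda>w::real^'n. exp (-((norm w)^2)))"
  unfolding exp_neg_norm_square_prod
  by (rule integrable_lborel_prod) (use has_bochner_integral_exp_neg_square in \<open>auto simp: has_bochner_integral_iff\<close>)

lemma powr_le_exp_square: "r powr q \<le> exp (q^2 / 2) * exp (r^2 / 2)" if "r \<ge> 0" "q \<ge> 0" for r q :: real
proof (cases "r = 0")
  case False
  then have r: "r > 0" using that by simp
  have "q * ln r \<le> q * r" using r ln_le_minus_one[OF r] that by (intro mult_left_mono) auto
  also have "\<dots> \<le> q^2 / 2 + r^2 / 2" using sum_squares_bound[of q r] by simp
  finally show ?thesis using r by (simp add: powr_def flip: exp_add)
qed simp

lemma integrable_powr_exp_neg_norm_square: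
  assumes "q \<ge> 0"
  shows "integrable lborel (\<lambda>w::real^'n. norm w powr q * exp (-((norm w)^2)))"
proof -
  have "integrable lborel (\<lambda>w::real^'n. exp (-((norm ((1 / sqrt 2) *\<^sub>R w))^2)))"
    by (subst integrable_lborel_scaleR) (auto intro: integrable_exp_neg_norm_square)
  then have "integrable lborel (\<lambda>w::real^'n. exp (q^2 / 2) * exp (-((norm w)^2 / 2)))"
    by (intro integrable_mult_right) (simp add: power_divide)
  then show ?thesis
  proof (rule Bochner_Integration.integrable_bound)
    have "norm w powr q * exp (-((norm w)^2)) \<le> exp (q^2 / 2) * exp (-((norm w)^2 / 2))" for w :: "real^'n"
    proof -
      have "norm w powr q * exp (-((norm w)^2)) \<le> exp (q^2 / 2) * exp ((norm w)^2 / 2) * exp (-((norm w)^2))"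
        using assms by (intro mult_right_mono powr_le_exp_square) auto
      also have "\<dots> = exp (q^2 / 2) * exp (-((norm w)^2 / 2))" by (simp flip: exp_add)
      finally show ?thesis .
    qed
    then show "AE w in lborel. norm (norm (w::real^'n) powr q * exp (-((norm w)^2))) \<le> norm (exp (q^2 / 2) * exp (-((norm w)^2 / 2)))"
      by (intro AE_I2) simp
  qed measurable
qed

lemma inner_matrix_vector_sum:
  fixes B :: "real^'n^'n"
  shows "u \<bullet> (B *v u) = (\<Sum>i\<in>UNIV. \<Sum>j\<in>UNIV. B $ i $ j * (u $ i * u $ j))"
  by (simp add: inner_vec_def matrix_vector_mult_def sum_distrib_left mult_ac)

lemma integral_gaussian_quadratic:
  fixes e :: "real^'n" and H :: "real^'n^'n"
  assumes p: "p \<ge> 2" and e: "norm e = 1"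
  shows "(\<integral>w. exp (-((norm w)^2)) * pweight p (e \<bullet> w) * (w \<bullet> (H *v w)) \<partial>lborel)
    = sqrt pi ^ CARD('n) * (Gamma ((p - 1) / 2) / sqrt pi) / 2 * (trace H + (p - 2) * (e \<bullet> (H *v e)))"
proof -
  obtain k :: 'n where True by simp
  obtain f :: "real^'n \<Rightarrow> real^'n" where f: "orthogonal_transformation f" "f (axis k 1) = e"
    using orthogonal_transformation_exists_1[of "axis k 1" e] e norm_axis_1 by metis
  define R where "R = matrix f"
  have fR: "f u = R *v u" for u
    unfolding R_def using orthogonal_transformation_linear[OF f(1)] by (simp add: matrix_works)
  have R: "orthogonal_matrix R"
    using f(1) by (simp add: R_def orthogonal_transformation_matrix)
  define B where "B = transpose R ** H ** R"
  have fB: "f u \<bullet> (H *v f u) = u \<bullet> (B *v u)" for u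
  proof -
    have "f u \<bullet> (H *v f u) = u \<bullet> (transpose R *v (H *v (R *v u)))"
      using dot_lmul_matrix[of u "transpose R"] by (simp add: fR vector_transpose_matrix)
    then show ?thesis by (simp add: B_def matrix_vector_mul_assoc matrix_mul_assoc)
  qed
  have "trace B = trace H"
  proof -
    have "trace B = trace (R ** (transpose R ** H))" unfolding B_def by (rule trace_mul_sym)
    also have "R ** (transpose R ** H) = H"
      using R by (simp add: matrix_mul_assoc orthogonal_matrix_def)
    finally show ?thesis .
  qed
  have Bk: "B $ k $ k = e \<bullet> (H *v e)"
  proof -
    have "e \<bullet> (H *v e) = axis k 1 \<bullet> (B *v axis k 1)" using fB[of "axis k 1"] f(2) by simp
    then show ?thesis by (simp add: inner_axis' matrix_vector_mult_basis column_def)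
  qed
  define C where "C = sqrt pi ^ CARD('n) * (Gamma ((p - 1) / 2) / sqrt pi)"
  have [measurable]: "(\<lambda>w. H *v w) \<in> borel_measurable borel"
    by (intro borel_measurable_continuous_onI linear_continuous_on matrix_vector_mul_bounded_linear)
  have "(\<integral>w. exp (-((norm w)^2)) * pweight p (e \<bullet> w) * (w \<bullet> (H *v w)) \<partial>lborel)
      = (\<integral>u. exp (-((norm (f u))^2)) * pweight p (e \<bullet> f u) * (f u \<bullet> (H *v f u)) \<partial>lborel)"
    by (rule integral_lborel_orthogonal[OF f(1), symmetric]) measurable
  also have "\<dots> = (\<integral>u. (\<Sum>i\<in>UNIV. \<Sum>j\<in>UNIV. B $ i $ j * (exp (-((norm u)^2)) * pweight p (u $ k) * (u $ i * u $ j))) \<partial>lborel)"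
  proof (rule Bochner_Integration.integral_cong[OF refl])
    fix u :: "real^'n"
    have "e \<bullet> f u = u $ k"
      using f by (metis inner_axis' inner_commute mult_1 orthogonal_transformation_def real_inner_1_right inner_real_def)
    then show "exp (-((norm (f u))^2)) * pweight p (e \<bullet> f u) * (f u \<bullet> (H *v f u))
        = (\<Sum>i\<in>UNIV. \<Sum>j\<in>UNIV. B $ i $ j * (exp (-((norm u)^2)) * pweight p (u $ k) * (u $ i * u $ j)))"
      unfolding fB unfolding inner_matrix_vector_sum sum_distrib_left orthogonal_transformation_norm[OF f(1)]
      by (simp add: mult_ac)
  qed
  also have "\<dots> = (\<Sum>i\<in>UNIV. \<Sum>j\<in>UNIV. B $ i $ j * (if i = j then C * (if i = k then (p - 1) / 2 else 1 / 2) else 0))"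
    unfolding C_def by (simp add: integrable_gaussian_moment[OF p] integral_gaussian_moment[OF p])
  also have "\<dots> = (\<Sum>i\<in>UNIV. B $ i $ i * (C * (if i = k then (p - 1) / 2 else 1 / 2)))"
    by (simp add: if_distrib[of "\<lambda>x. _ * x"] sum.delta cong: if_cong)
  also have "\<dots> = (\<Sum>i\<in>UNIV. C / 2 * B $ i $ i + (if i = k then C / 2 * (p - 2) * B $ i $ i else 0))"
    by (intro sum.cong) (auto simp: field_simps)
  also have "\<dots> = C / 2 * (trace B + (p - 2) * B $ k $ k)"
    by (simp add: sum.distrib sum_distrib_left[symmetric] sum_divide_distrib[symmetric] trace_def distrib_left mult.assoc)
  finally show ?thesis by (simp add: C_def \<open>trace B = trace H\<close> Bk)
qed

section \<open>Subordination of the fractional kernel to Gaussians\<close>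

lemma has_bochner_integral_powr_from_0:
  assumes "q > (-1::real)"
  shows "has_bochner_integral lborel (\<lambda>t. indicator {0..1} t * t powr q) (1 / (q + 1))"
  using has_integral_powr_from_0[of q 1] assms
  by (intro has_bochner_integral_lborel_nonneg) auto

lemma has_bochner_integral_powr_to_inf:
  assumes "q < (-1::real)"
  shows "has_bochner_integral lborel (\<lambda>t. indicator {1..} t * t powr q) (- 1 / (q + 1))"
  using has_integral_powr_to_inf[of q 1] assms
  by (intro has_bochner_integral_lborel_nonneg) auto

lemma has_bochner_integral_powr_exp_scaled:
  fixes r a :: real
  assumes r: "r > 0" and a: "a > 0"
  shows "has_bochner_integral lborel (\<lambda>t. indicator {0<..} t * t powr (a - 1) * exp (- (t * r^2)))
    (Gamma a * r powr (- (2 * a)))"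
proof -
  have "has_bochner_integral lborel (\<lambda>t. indicator {0..} t * (t powr (a - 1) / exp t)) (Gamma a)"
    using Gamma_integral_real[OF a] by (intro has_bochner_integral_lborel_nonneg) auto
  then have "has_bochner_integral lborel (\<lambda>t. indicator {0..} (0 + r^2 * t) * ((0 + r^2 * t) powr (a - 1) / exp (0 + r^2 * t)))
      (Gamma a /\<^sub>R \<bar>r^2\<bar>)"
    using r by (subst (asm) lborel_has_bochner_integral_real_affine_iff[where c="r^2" and t=0]) auto
  then have H: "has_bochner_integral lborel (\<lambda>t. (r^2) powr (1 - a) * (indicator {0..} (0 + r^2 * t) * ((0 + r^2 * t) powr (a - 1) / exp (0 + r^2 * t))))
      ((r^2) powr (1 - a) * (Gamma a /\<^sub>R \<bar>r^2\<bar>))"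
    by (rule has_bochner_integral_mult_right)
  have E1: "(r^2) powr (1 - a) * (Gamma a /\<^sub>R \<bar>r^2\<bar>) = Gamma a * r powr (- (2 * a))"
  proof -
    have "(r^2) powr (1 - a) = r powr (2 * (1 - a))" using r by (simp add: powr_powr flip: powr_numeral)
    also have "\<dots> = r powr (- (2 * a)) * r^2" 
    proof -
      have "2 * (1 - a) = - (2 * a) + 2" by simp
      then show ?thesis using r by (simp only: powr_add powr_numeral less_imp_le)
    qed
    finally show ?thesis using r by simp
  qed
  have E2: "(r^2) powr (1 - a) * (indicator {0..} (0 + r^2 * t) * ((0 + r^2 * t) powr (a - 1) / exp (0 + r^2 * t)))
      = indicator {0<..} t * t powr (a - 1) * exp (- (t * r^2))" for t
  proof (cases "t > 0")
    case True
    have "(r^2) powr (1 - a) * (r^2) powr (a - 1) = 1" using r by (simp flip: powr_add)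
    then have *: "(r^2) powr (1 - a) * ((r^2) powr (a - 1) * y) = y" for y
      by (simp add: mult.assoc[symmetric])
    show ?thesis using True r by (simp add: powr_mult exp_minus divide_inverse mult.assoc * mult.commute[of t])
  next
    case False
    then have "t = 0 \<or> r^2 * t < 0" using r by (auto simp: mult_less_0_iff)
    then show ?thesis using False by (auto simp: indicator_def)
  qed
  show ?thesis using H by (simp only: E1 E2)
qed

lemma le_mult_min1:
  fixes c M y :: real
  assumes "c \<le> M * min 1 y" "M \<ge> 0"
  shows "c \<le> M" "c \<le> M * y"
  using assms(1) mult_left_mono[OF min.cobounded1[of 1 y] assms(2)] mult_left_mono[OF min.cobounded2[of 1 y] assms(2)]
  by linarith+

definition gauss_dilation :: "(real^'n \<Rightarrow> real) \<Rightarrow> real \<Rightarrow> real" where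
  "gauss_dilation S t = (\<integral>w. exp (- ((norm w)^2)) * S ((1 / sqrt t) *\<^sub>R w) \<partial>lborel)"

lemma borel_measurable_gauss_dilation [measurable]:
  assumes [measurable]: "S \<in> borel_measurable borel"
  shows "gauss_dilation S \<in> borel_measurable borel"
  unfolding gauss_dilation_def by measurable

lemma integrable_gauss_dilation:
  fixes S :: "real^'n \<Rightarrow> real"
  assumes [measurable]: "S \<in> borel_measurable borel" and S: "\<And>z. \<bar>S z\<bar> \<le> M"
  shows "integrable lborel (\<lambda>w. exp (- ((norm w)^2)) * S (c *\<^sub>R w))"
proof (rule Bochner_Integration.integrable_bound)
  show "integrable lborel (\<lambda>w::real^'n. M * exp (- ((norm w)^2)))"
    by (intro integrable_mult_right integrable_exp_neg_norm_square)
  show "AE w in lborel. norm (exp (- ((norm w)^2)) * S (c *\<^sub>R w)) \<le> norm (M * exp (- ((norm w)^2)))"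
    using order_trans[OF S abs_ge_self] by (intro AE_I2) (simp add: abs_mult mult.commute)
qed measurable

lemma gauss_dilation_bound:
  assumes p: "p \<ge> 0" and M: "M \<ge> 0"
  obtains C where "C \<ge> 0"
    "\<And>S t. (S :: real^'n \<Rightarrow> real) \<in> borel_measurable borel \<Longrightarrow> (\<And>z. \<bar>S z\<bar> \<le> M * min 1 (norm z powr p)) \<Longrightarrow> t > 0 \<Longrightarrow>
       \<bar>gauss_dilation S t\<bar> \<le> C * min 1 (t powr (- p / 2))"
proof -
  define A where "A = (\<integral>w. exp (- ((norm (w::real^'n))^2)) \<partial>lborel)"
  define B where "B = (\<integral>w. norm (w::real^'n) powr p * exp (- ((norm w)^2)) \<partial>lborel)"
  have AB: "A \<ge> 0" "B \<ge> 0" by (simp_all add: A_def B_def)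
  show ?thesis
  proof (rule that[of "M * (A + B)"])
    show "M * (A + B) \<ge> 0" using AB M by simp
  next
    fix S :: "real^'n \<Rightarrow> real" and t :: real
    assume [measurable]: "S \<in> borel_measurable borel"
      and S: "\<And>z. \<bar>S z\<bar> \<le> M * min 1 (norm z powr p)" and t: "t > 0"
    have S1: "\<bar>S z\<bar> \<le> M" for z using le_mult_min1(1)[OF S M] .
    have Sp: "\<bar>S z\<bar> \<le> M * norm z powr p" for z using le_mult_min1(2)[OF S M] .
    have int: "integrable lborel (\<lambda>w. \<bar>exp (- ((norm w)^2)) * S ((1 / sqrt t) *\<^sub>R w)\<bar>)"
      by (rule integrable_abs[OF integrable_gauss_dilation[OF _ S1]]) measurable
    have le: "\<bar>gauss_dilation S t\<bar> \<le> (\<integral>w. \<bar>exp (- ((norm w)^2)) * S ((1 / sqrt t) *\<^sub>R w)\<bar> \<partial>lborel)"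
      unfolding gauss_dilation_def by (rule integral_abs_bound)
    have "\<bar>gauss_dilation S t\<bar> \<le> M * A"
    proof -
      have "(\<integral>w. \<bar>exp (- ((norm w)^2)) * S ((1 / sqrt t) *\<^sub>R w)\<bar> \<partial>lborel) \<le> (\<integral>w. M * exp (- ((norm (w::real^'n))^2)) \<partial>lborel)"
        by (intro integral_mono int integrable_mult_right integrable_exp_neg_norm_square)
           (simp add: abs_mult S1 mult.commute)
      then show ?thesis using le by (simp add: A_def)
    qed
    moreover have "\<bar>gauss_dilation S t\<bar> \<le> M * B * t powr (- p / 2)"
    proof -
      have "\<bar>exp (- ((norm w)^2)) * S ((1 / sqrt t) *\<^sub>R w)\<bar> \<le> M * t powr (- p / 2) * (norm w powr p * exp (- ((norm w)^2)))" for w :: "real^'n"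
      proof -
        have "(norm ((1 / sqrt t) *\<^sub>R w)) powr p = t powr (- p / 2) * norm w powr p"
          using t by (simp add: powr_mult powr_divide powr_half_sqrt[symmetric] powr_powr powr_minus field_simps)
        then show ?thesis using mult_left_mono[OF Sp[of "(1 / sqrt t) *\<^sub>R w"], of "exp (- ((norm w)^2))"]
          by (simp add: abs_mult mult_ac)
      qed
      then have "(\<integral>w. \<bar>exp (- ((norm w)^2)) * S ((1 / sqrt t) *\<^sub>R w)\<bar> \<partial>lborel)
          \<le> (\<integral>w. M * t powr (- p / 2) * (norm (w::real^'n) powr p * exp (- ((norm w)^2))) \<partial>lborel)"
        using p by (intro integral_mono int integrable_mult_right integrable_powr_exp_neg_norm_square)
      also have "\<dots> = M * t powr (- p / 2) * B" unfolding B_def by simp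
      finally show ?thesis using le by (simp add: mult.assoc mult.commute[of B])
    qed
    moreover have "M * A \<le> M * (A + B)" "M * B * t powr (- p / 2) \<le> M * (A + B) * t powr (- p / 2)"
      using AB M by (auto intro!: mult_left_mono mult_right_mono)
    ultimately show "\<bar>gauss_dilation S t\<bar> \<le> M * (A + B) * min 1 (t powr (- p / 2))"
      by (auto simp: min_def)
  qed
qed

lemma integrable_powr_min:
  fixes m :: "real \<Rightarrow> real"
  assumes [measurable]: "m \<in> borel_measurable borel" and p: "p > 0" and s: "0 < s" "s < 1" and C: "C \<ge> 0"
    and m: "\<And>t. t > 0 \<Longrightarrow> \<bar>m t\<bar> \<le> C * min 1 (t powr (- p / 2))"
  shows "integrable lborel (\<lambda>t. indicator {0<..} t * t powr (s * p / 2 - 1) * m t)"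
proof (rule Bochner_Integration.integrable_bound)
  have *: "s * p / 2 - 1 > -1" "s * p / 2 - 1 - p / 2 < -1" using p s by auto
  show "integrable lborel (\<lambda>t. C * (indicator {0..1} t * t powr (s * p / 2 - 1)) + C * (indicator {1..} t * t powr (s * p / 2 - 1 - p / 2)))"
    by (intro Bochner_Integration.integrable_add integrable_mult_right
        has_bochner_integral_iff[THEN iffD1, THEN conjunct1, OF has_bochner_integral_powr_from_0[OF *(1)]]
        has_bochner_integral_iff[THEN iffD1, THEN conjunct1, OF has_bochner_integral_powr_to_inf[OF *(2)]])
  show "AE t in lborel. norm (indicator {0<..} t * t powr (s * p / 2 - 1) * m t)
      \<le> norm (C * (indicator {0..1} t * t powr (s * p / 2 - 1)) + C * (indicator {1..} t * t powr (s * p / 2 - 1 - p / 2)))"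
  proof (rule AE_I2)
    fix t :: real
    have "t powr (s * p / 2 - 1) * \<bar>m t\<bar> \<le> C * (indicator {0..1} t * t powr (s * p / 2 - 1)) + C * (indicator {1..} t * t powr (s * p / 2 - 1 - p / 2))"
      if t: "t > 0"
    proof (cases "t \<le> 1")
      case True
      have "\<bar>m t\<bar> \<le> C" using le_mult_min1(1)[OF m[OF t] C] .
      then have "t powr (s * p / 2 - 1) * \<bar>m t\<bar> \<le> t powr (s * p / 2 - 1) * C" by (intro mult_left_mono) auto
      then show ?thesis using True t C by (auto simp: indicator_def mult.commute)
    next
      case False
      have "\<bar>m t\<bar> \<le> C * t powr (- p / 2)" using le_mult_min1(2)[OF m[OF t] C] .
      then have "t powr (s * p / 2 - 1) * \<bar>m t\<bar> \<le> t powr (s * p / 2 - 1) * (C * t powr (- p / 2))" by (intro mult_left_mono) auto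
      also have "\<dots> = C * t powr (s * p / 2 - 1 - p / 2)" by (simp add: mult.left_commute flip: powr_add)
      finally show ?thesis using False by (simp add: indicator_def)
    qed
    then show "norm (indicator {0<..} t * t powr (s * p / 2 - 1) * m t)
      \<le> norm (C * (indicator {0..1} t * t powr (s * p / 2 - 1)) + C * (indicator {1..} t * t powr (s * p / 2 - 1 - p / 2)))"
      using C by (cases "t > 0") (auto simp: abs_mult intro: order_trans)
  qed
qed measurable

lemma integral_exp_neg_square_scaled:
  fixes S :: "real^'n \<Rightarrow> real"
  assumes [measurable]: "S \<in> borel_measurable borel" and S: "\<And>z. \<bar>S z\<bar> \<le> M" and t: "t > 0"
  shows "integrable lborel (\<lambda>z. exp (- (t * (norm z)^2)) * S z)"
    and "(\<integral>z. exp (- (t * (norm z)^2)) * S z \<partial>lborel) = t powr (- real CARD('n) / 2) * gauss_dilation S t"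
proof -
  have c: "1 / sqrt t > 0" using t by simp
  have eq: "exp (- (t * (norm ((1 / sqrt t) *\<^sub>R w))^2)) * S ((1 / sqrt t) *\<^sub>R w)
      = exp (- ((norm w)^2)) * S ((1 / sqrt t) *\<^sub>R w)" for w
    using t by (simp add: power_mult_distrib power_divide)
  show "integrable lborel (\<lambda>z. exp (- (t * (norm z)^2)) * S z)"
  proof (rule integrable_lborel_scaleR[OF c, THEN iffD1])
    show "integrable lborel (\<lambda>w. exp (- (t * (norm ((1 / sqrt t) *\<^sub>R w))^2)) * S ((1 / sqrt t) *\<^sub>R w))"
      unfolding eq by (rule integrable_gauss_dilation[OF _ S]) measurable
  qed measurable
  have pow: "(1 / sqrt t) ^ CARD('n) = t powr (- real CARD('n) / 2)"
  proof -
    have "1 / sqrt t = t powr (- (1 / 2))"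
      using t by (simp add: powr_minus powr_half_sqrt inverse_eq_divide)
    then show ?thesis using t by (simp add: powr_power)
  qed
  have g: "(\<lambda>z. exp (- (t * (norm z)^2)) * S z) \<in> borel_measurable borel" by measurable
  have I: "(\<integral>z. exp (- (t * (norm z)^2)) * S z \<partial>lborel)
      = (1 / sqrt t) ^ CARD('n) * (\<integral>w. exp (- (t * (norm ((1 / sqrt t) *\<^sub>R w))^2)) * S ((1 / sqrt t) *\<^sub>R w) \<partial>lborel)"
    using integral_lborel_scaleR[OF c g] by (simp only: DIM_cart DIM_real mult_1_right)
  show "(\<integral>z. exp (- (t * (norm z)^2)) * S z \<partial>lborel) = t powr (- real CARD('n) / 2) * gauss_dilation S t"
    unfolding I eq pow gauss_dilation_def ..
qed

lemma
  fixes S :: "real^'n \<Rightarrow> real"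
  assumes S [measurable]: "S \<in> borel_measurable borel" and p: "p > 0" and s: "0 < s" "s < 1" and M: "M \<ge> 0"
    and b: "\<And>z. \<bar>S z\<bar> \<le> M * min 1 (norm z powr p)"
  shows integrable_fractional_kernel:
      "integrable lborel (\<lambda>z. S z / norm z powr (real CARD('n) + s * p))" (is ?int)
    and integral_fractional_kernel:
      "Gamma ((real CARD('n) + s * p) / 2) * (\<integral>z. S z / norm z powr (real CARD('n) + s * p) \<partial>lborel)
       = (\<integral>t. indicator {0<..} t * t powr (s * p / 2 - 1) * gauss_dilation S t \<partial>lborel)" (is ?eq)
proof -
  define a where "a = (real CARD('n) + s * p) / 2"
  have a: "a > 0" using p s by (simp add: a_def add_pos_pos)
  define F where "F t z = indicator {0<..} t * t powr (a - 1) * (exp (- (t * (norm z)^2)) * S z)" for t :: real and z :: "real^'n"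
  have [measurable]: "case_prod F \<in> borel_measurable (lborel \<Otimes>\<^sub>M lborel)"
    unfolding F_def by measurable
  obtain C where C: "C \<ge> 0" and dil: "\<And>S t. (S :: real^'n \<Rightarrow> real) \<in> borel_measurable borel
      \<Longrightarrow> (\<And>z. \<bar>S z\<bar> \<le> M * min 1 (norm z powr p)) \<Longrightarrow> t > 0 \<Longrightarrow> \<bar>gauss_dilation S t\<bar> \<le> C * min 1 (t powr (- p / 2))"
    using gauss_dilation_bound[of p M] p M by (metis less_imp_le)
  have S1: "\<bar>S z\<bar> \<le> M" for z using le_mult_min1(1)[OF b M] .
  have pw: "t powr (a - 1) * (t powr (- real CARD('n) / 2) * x) = t powr (s * p / 2 - 1) * x" for t x :: real
  proof -
    have "a - 1 + - real CARD('n) / 2 = s * p / 2 - 1" by (simp add: a_def add_divide_distrib)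
    then show ?thesis by (simp only: powr_add[symmetric] mult.assoc[symmetric])
  qed
  have abs_S: "(\<lambda>z. \<bar>S z\<bar>) \<in> borel_measurable borel" "\<And>z. \<bar>\<bar>S z\<bar>\<bar> \<le> M" using S1 by auto
  have abs_F: "norm (F t z) = indicator {0<..} t * t powr (a - 1) * (exp (- (t * (norm z)^2)) * \<bar>S z\<bar>)" for t z
    by (simp add: F_def abs_mult)
  have slice: "(\<integral>z. indicator {0<..} t * t powr (a - 1) * (exp (- (t * (norm z)^2)) * R z) \<partial>lborel)
      = indicator {0<..} t * t powr (s * p / 2 - 1) * gauss_dilation R t"
    if "R \<in> borel_measurable borel" "\<And>z. \<bar>R z\<bar> \<le> M" for R :: "real^'n \<Rightarrow> real" and t
  proof (cases "t > 0")
    case True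
    then show ?thesis
      unfolding integral_mult_right_zero integral_exp_neg_square_scaled(2)[OF that True] mult.assoc pw by simp
  qed simp
  have Fz: "integrable lborel (F t)" "(\<integral>z. F t z \<partial>lborel) = indicator {0<..} t * t powr (s * p / 2 - 1) * gauss_dilation S t"
    "(\<integral>z. norm (F t z) \<partial>lborel) = indicator {0<..} t * t powr (s * p / 2 - 1) * gauss_dilation (\<lambda>z. \<bar>S z\<bar>) t" for t
  proof -
    show "integrable lborel (F t)"
    proof (cases "t > 0")
      case True
      then show ?thesis unfolding F_def[abs_def]
        by (intro integrable_mult_right integral_exp_neg_square_scaled(1)[OF S S1])
    qed (simp add: F_def[abs_def])
    show "(\<integral>z. F t z \<partial>lborel) = indicator {0<..} t * t powr (s * p / 2 - 1) * gauss_dilation S t"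
      unfolding F_def by (rule slice[OF S S1])
    show "(\<integral>z. norm (F t z) \<partial>lborel) = indicator {0<..} t * t powr (s * p / 2 - 1) * gauss_dilation (\<lambda>z. \<bar>S z\<bar>) t"
      unfolding abs_F by (rule slice[OF abs_S])
  qed
  have Fint: "integrable (lborel \<Otimes>\<^sub>M lborel) (case_prod F)"
  proof (rule lborel_pair.Fubini_integrable)
    have "integrable lborel (\<lambda>t. indicator {0<..} t * t powr (s * p / 2 - 1) * gauss_dilation (\<lambda>z. \<bar>S z\<bar>) t)"
    proof (rule integrable_powr_min[OF _ p s C])
      show "\<bar>gauss_dilation (\<lambda>z. \<bar>S z\<bar>) t\<bar> \<le> C * min 1 (t powr (- p / 2))" if "t > 0" for t
        by (rule dil[OF abs_S(1) _ that]) (use b in simp)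
    qed measurable
    then show "integrable lborel (\<lambda>t. \<integral>z. norm (case (t, z) of (t, z) \<Rightarrow> F t z) \<partial>lborel)"
      by (simp only: prod.case Fz(3))
  qed (simp_all add: Fz)
  have Ft: "(\<integral>t. F t z \<partial>lborel) = Gamma a * (S z / norm z powr (real CARD('n) + s * p))" for z
  proof (cases "z = 0")
    case True
    then have "S z = 0" using b[of z] by simp
    then show ?thesis by (simp add: F_def)
  next
    case False
    have "(\<integral>t. F t z \<partial>lborel) = (\<integral>t. (indicator {0<..} t * t powr (a - 1) * exp (- (t * (norm z)^2))) * S z \<partial>lborel)"
      by (simp add: F_def mult.assoc)
    also have "\<dots> = Gamma a * norm z powr (- (2 * a)) * S z"
      using False a
      by (intro has_bochner_integral_integral_eq has_bochner_integral_mult_left has_bochner_integral_powr_exp_scaled) auto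
    also have "2 * a = real CARD('n) + s * p" by (simp add: a_def)
    also have "Gamma a * norm z powr (- (real CARD('n) + s * p)) * S z = Gamma a * (S z / norm z powr (real CARD('n) + s * p))"
      by (simp only: powr_minus divide_inverse mult_ac)
    finally show ?thesis .
  qed
  have G: "Gamma a > 0" using a by simp
  have "integrable lborel (\<lambda>z. inverse (Gamma a) * (Gamma a * (S z / norm z powr (real CARD('n) + s * p))))"
    using lborel_pair.integrable_snd[OF Fint] unfolding Ft by (rule integrable_mult_right)
  moreover have "inverse (Gamma a) * (Gamma a * y) = y" for y
    using G by (simp flip: mult.assoc)
  ultimately show ?int by (simp only:)
  have "Gamma a * (\<integral>z. S z / norm z powr (real CARD('n) + s * p) \<partial>lborel)
      = (\<integral>z. Gamma a * (S z / norm z powr (real CARD('n) + s * p)) \<partial>lborel)"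
    by (rule integral_mult_right_zero[symmetric])
  also have "\<dots> = (\<integral>t. indicator {0<..} t * t powr (s * p / 2 - 1) * gauss_dilation S t \<partial>lborel)"
    using lborel_pair.integral_fst[OF Fint] lborel_pair.integral_snd[OF Fint] unfolding Ft Fz(2) by simp
  finally show ?eq unfolding a_def .
qed

lemma gauss_dilation_limit:
  fixes S Q :: "real^'n \<Rightarrow> real"
  assumes [measurable]: "S \<in> borel_measurable borel" "Q \<in> borel_measurable borel" and p: "p \<ge> 0"
    and b: "\<And>z. \<bar>S z\<bar> \<le> M * norm z powr p"
    and lim: "\<And>w. ((\<lambda>h. S (h *\<^sub>R w) / h powr p) \<longlongrightarrow> Q w) (at_right 0)"
  shows "((\<lambda>t. t powr (p / 2) * gauss_dilation S t) \<longlongrightarrow> (\<integral>w. exp (- ((norm w)^2)) * Q w \<partial>lborel)) at_top"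
proof -
  have scale: "t powr (p / 2) = 1 / (1 / sqrt t) powr p" if "t > 0" for t
    using that by (simp add: powr_divide powr_half_sqrt[symmetric] powr_powr)
  have "((\<lambda>t. \<integral>w. t powr (p / 2) * (exp (- ((norm w)^2)) * S ((1 / sqrt t) *\<^sub>R w)) \<partial>lborel)
      \<longlongrightarrow> (\<integral>w. exp (- ((norm w)^2)) * Q w \<partial>lborel)) at_top"
  proof (rule integral_dominated_convergence_at_top)
    show "integrable lborel (\<lambda>w::real^'n. M * (norm w powr p * exp (- ((norm w)^2))))"
      using p by (intro integrable_mult_right integrable_powr_exp_neg_norm_square)
    show "AE w in lborel. ((\<lambda>t. t powr (p / 2) * (exp (- ((norm w)^2)) * S ((1 / sqrt t) *\<^sub>R w)))
        \<longlongrightarrow> exp (- ((norm w)^2)) * Q w) at_top"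
    proof (rule AE_I2)
      fix w :: "real^'n"
      have "filterlim (\<lambda>t::real. 1 / sqrt t) (at_right 0) at_top"
        unfolding filterlim_at
      proof safe
        show "((\<lambda>t::real. 1 / sqrt t) \<longlongrightarrow> 0) at_top"
          by (intro tendsto_divide_0[OF tendsto_const] filterlim_at_top_imp_at_infinity sqrt_at_top)
        show "\<forall>\<^sub>F t::real in at_top. 1 / sqrt t \<in> {0<..} \<and> 1 / sqrt t \<noteq> 0"
          using eventually_gt_at_top[of "0::real"] by eventually_elim auto
      qed
      from tendsto_mult[OF tendsto_const[of "exp (- ((norm w)^2))"] filterlim_compose[OF lim this, of w]]
      show "((\<lambda>t. t powr (p / 2) * (exp (- ((norm w)^2)) * S ((1 / sqrt t) *\<^sub>R w)))
        \<longlongrightarrow> exp (- ((norm w)^2)) * Q w) at_top"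
      proof (rule Lim_transform_eventually)
        show "\<forall>\<^sub>F t in at_top. exp (- ((norm w)^2)) * (S ((1 / sqrt t) *\<^sub>R w) / (1 / sqrt t) powr p)
            = t powr (p / 2) * (exp (- ((norm w)^2)) * S ((1 / sqrt t) *\<^sub>R w))"
          using eventually_gt_at_top[of "0::real"] by eventually_elim (simp add: scale)
      qed
    qed
    show "\<forall>\<^sub>F t in at_top. AE w in lborel. norm (t powr (p / 2) * (exp (- ((norm w)^2)) * S ((1 / sqrt t) *\<^sub>R w)))
        \<le> M * (norm w powr p * exp (- ((norm w)^2)))"
      using eventually_gt_at_top[of "0::real"]
    proof eventually_elim
      case (elim t)
      show ?case
      proof (rule AE_I2)
        fix w :: "real^'n"
        have "t powr (p / 2) * \<bar>S ((1 / sqrt t) *\<^sub>R w)\<bar> \<le> t powr (p / 2) * (M * norm ((1 / sqrt t) *\<^sub>R w) powr p)"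
          by (intro mult_left_mono b) auto
        also have "\<dots> = M * norm w powr p"
          using elim by (simp add: scale powr_divide)
        finally have "exp (- ((norm w)^2)) * (t powr (p / 2) * \<bar>S ((1 / sqrt t) *\<^sub>R w)\<bar>) \<le> exp (- ((norm w)^2)) * (M * norm w powr p)"
          by (intro mult_left_mono) auto
        then show "norm (t powr (p / 2) * (exp (- ((norm w)^2)) * S ((1 / sqrt t) *\<^sub>R w)))
          \<le> M * (norm w powr p * exp (- ((norm w)^2)))"
          by (simp add: abs_mult mult_ac)
      qed
    qed
  qed measurable
  then show ?thesis by (simp add: gauss_dilation_def)
qed

lemma abelian_powr_limit:
  fixes m :: "real \<Rightarrow> real"
  assumes [measurable]: "m \<in> borel_measurable borel" and p: "p > 0" and C: "C \<ge> 0"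
    and m: "\<And>t. t > 0 \<Longrightarrow> \<bar>m t\<bar> \<le> C * min 1 (t powr (- p / 2))"
    and lim: "((\<lambda>t. t powr (p / 2) * m t) \<longlongrightarrow> L) at_top"
  shows "((\<lambda>s. (1 - s) * (\<integral>t. indicator {0<..} t * t powr (s * p / 2 - 1) * m t \<partial>lborel)) \<longlongrightarrow> 2 / p * L) (at_left 1)"
proof (rule tendstoI)
  fix e :: real assume e: "e > 0"
  define \<epsilon> where "\<epsilon> = e * p / 4"
  have \<epsilon>: "\<epsilon> > 0" using e p by (simp add: \<epsilon>_def)
  obtain T where T: "\<And>t. t \<ge> T \<Longrightarrow> \<bar>t powr (p / 2) * m t - L\<bar> < \<epsilon>"
    using tendstoD[OF lim \<epsilon>] by (auto simp: eventually_at_top_linorder dist_real_def)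
  define K where "K t = C * (indicator {0..1} t * t powr (p / 4 - 1)) + (C + \<bar>L\<bar>) * indicator {1..max 1 T} t" for t
  have q: "p / 4 - 1 > -1" using p by simp
  have "integrable lborel (\<lambda>t. indicator {1..max 1 T} t :: real)" by (rule integrable_real_indicator) auto
  then have Kint: "integrable lborel K"
    unfolding K_def[abs_def] using has_bochner_integral_powr_from_0[OF q] by (simp add: has_bochner_integral_iff)
  have main: "dist ((1 - s) * (\<integral>t. indicator {0<..} t * t powr (s * p / 2 - 1) * m t \<partial>lborel)) (2 / p * L)
      \<le> (1 - s) * (\<integral>t. K t \<partial>lborel) + e / 2" if s: "1 / 2 \<le> s" "s < 1" for s
  proof -
    define g where "g t = indicator {0<..} t * t powr (s * p / 2 - 1) * m t" for t
    define h where "h t = indicator {1..} t * t powr (s * p / 2 - 1 - p / 2)" for t :: real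
    have s0: "0 < s" using s by simp
    have q': "s * p / 2 - 1 - p / 2 < -1" using p s by simp
    have gint: "integrable lborel g"
      unfolding g_def[abs_def] by (rule integrable_powr_min[OF _ p s0 s(2) C m]) measurable
    have hb: "has_bochner_integral lborel h (2 / (p * (1 - s)))"
    proof -
      have "s * p / 2 - p / 2 = - (p * (1 - s) / 2)" by (simp add: field_simps)
      then have "- 1 / (s * p / 2 - 1 - p / 2 + 1) = 2 / (p * (1 - s))" using p s by simp
      then show ?thesis using has_bochner_integral_powr_to_inf[OF q'] unfolding h_def[abs_def] by simp
    qed
    have bound: "\<bar>g t - h t * L\<bar> \<le> K t + \<epsilon> * h t" for t
    proof -
      consider "t \<le> 0" | "0 < t" "t < 1" | "t \<ge> 1" "t < T" | "t \<ge> 1" "t \<ge> T" by linarith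
      then show ?thesis
      proof cases
        case 1
        then show ?thesis using C \<epsilon> by (auto simp: g_def h_def K_def indicator_def)
      next
        case 2
        have "\<bar>m t\<bar> \<le> C" using le_mult_min1(1)[OF m[OF 2(1)] C] .
        moreover have "t powr (s * p / 2 - 1) \<le> t powr (p / 4 - 1)"
          using 2 s p by (intro powr_mono') (auto simp: field_simps)
        ultimately have "t powr (s * p / 2 - 1) * \<bar>m t\<bar> \<le> t powr (p / 4 - 1) * C" by (intro mult_mono) auto
        then show ?thesis using 2 by (simp add: g_def h_def K_def indicator_def abs_mult mult.commute)
      next
        case 3
        have "\<bar>m t\<bar> \<le> C * t powr (- p / 2)" using le_mult_min1(2)[OF m C] 3 by simp
        then have "t powr (p / 2) * \<bar>m t\<bar> \<le> t powr (p / 2) * (C * t powr (- p / 2))" by (intro mult_left_mono) auto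
        also have "\<dots> = C" using 3 by (simp add: mult.left_commute flip: powr_add)
        finally have k: "\<bar>t powr (p / 2) * m t\<bar> \<le> C" by (simp add: abs_mult)
        have "g t - h t * L = t powr (s * p / 2 - 1 - p / 2) * (t powr (p / 2) * m t - L)"
          using 3 by (simp add: g_def h_def right_diff_distrib flip: powr_add mult.assoc)
        also have "\<bar>\<dots>\<bar> \<le> 1 * (C + \<bar>L\<bar>)"
          unfolding abs_mult
        proof (intro mult_mono)
          show "\<bar>t powr (s * p / 2 - 1 - p / 2)\<bar> \<le> 1"
            using 3 q' powr_mono[of "s * p / 2 - 1 - p / 2" 0 t] by simp
        qed (use k in auto)
        finally have "\<bar>g t - h t * L\<bar> \<le> C + \<bar>L\<bar>" by simp
        also have "\<dots> \<le> K t" using 3 C by (auto simp: K_def indicator_def)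
        also have "\<dots> \<le> K t + \<epsilon> * h t" using \<epsilon> by (simp add: h_def)
        finally show ?thesis .
      next
        case 4
        have "g t - h t * L = t powr (s * p / 2 - 1 - p / 2) * (t powr (p / 2) * m t - L)"
          using 4 by (simp add: g_def h_def right_diff_distrib flip: powr_add mult.assoc)
        also have "\<bar>\<dots>\<bar> \<le> t powr (s * p / 2 - 1 - p / 2) * \<epsilon>"
          using T[OF 4(2)] by (simp add: abs_mult mult_left_mono)
        also have "\<dots> = \<epsilon> * h t" using 4 by (simp add: h_def)
        finally have "\<bar>g t - h t * L\<bar> \<le> \<epsilon> * h t" .
        moreover have "0 \<le> K t" using C by (simp add: K_def)
        ultimately show ?thesis by linarith
      qed
    qed
    have hint: "integrable lborel h" "(\<integral>t. h t \<partial>lborel) = 2 / (p * (1 - s))"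
      using hb by (auto simp: has_bochner_integral_iff)
    have L: "2 / p * L = (1 - s) * (\<integral>t. h t * L \<partial>lborel)" using hint s p by (simp add: field_simps)
    have "dist ((1 - s) * (\<integral>t. g t \<partial>lborel)) (2 / p * L)
        = \<bar>(1 - s) * ((\<integral>t. g t \<partial>lborel) - (\<integral>t. h t * L \<partial>lborel))\<bar>"
      unfolding L dist_real_def right_diff_distrib ..
    also have "(\<integral>t. g t \<partial>lborel) - (\<integral>t. h t * L \<partial>lborel) = (\<integral>t. g t - h t * L \<partial>lborel)"
      using gint hint by (intro Bochner_Integration.integral_diff[symmetric]) auto
    also have "\<bar>(1 - s) * \<dots>\<bar> = (1 - s) * \<bar>\<integral>t. g t - h t * L \<partial>lborel\<bar>"
      using s by (simp add: abs_mult)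
    also have "\<bar>\<integral>t. g t - h t * L \<partial>lborel\<bar> \<le> (\<integral>t. \<bar>g t - h t * L\<bar> \<partial>lborel)"
      by (rule integral_abs_bound)
    also have "\<dots> \<le> (\<integral>t. K t + \<epsilon> * h t \<partial>lborel)"
      using bound gint hint Kint by (intro integral_mono) auto
    also have "\<dots> = (\<integral>t. K t \<partial>lborel) + \<epsilon> * (2 / (p * (1 - s)))"
      using hint Kint by simp
    finally have "dist ((1 - s) * (\<integral>t. g t \<partial>lborel)) (2 / p * L) \<le> (1 - s) * ((\<integral>t. K t \<partial>lborel) + \<epsilon> * (2 / (p * (1 - s))))"
      using s by (simp add: mult_left_mono)
    also have "\<dots> = (1 - s) * (\<integral>t. K t \<partial>lborel) + e / 2"
      using s p by (simp add: \<epsilon>_def field_simps)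
    finally show ?thesis by (simp add: g_def)
  qed
  have "((\<lambda>s. (1 - s) * (\<integral>t. K t \<partial>lborel)) \<longlongrightarrow> (1 - 1) * (\<integral>t. K t \<partial>lborel)) (at_left 1)"
    by (intro tendsto_intros)
  then have "\<forall>\<^sub>F s in at_left 1. (1 - s) * (\<integral>t. K t \<partial>lborel) < e / 2"
    using e by (intro order_tendstoD) auto
  moreover have "\<forall>\<^sub>F s in at_left (1::real). 1 / 2 \<le> s \<and> s < 1"
    using eventually_at_left_real[of "1/2" "1::real"] by (auto elim: eventually_mono)
  ultimately show "\<forall>\<^sub>F s in at_left 1. dist ((1 - s) * (\<integral>t. indicator {0<..} t * t powr (s * p / 2 - 1) * m t \<partial>lborel)) (2 / p * L) < e"
    by eventually_elim (use main in force)
qed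

section \<open>Symmetrized differences of a \<open>C\<^sup>2\<close> function\<close>

lemma Phi_uminus: "Phi p (- t) = - Phi p t"
  by (simp add: Phi_def)

lemma Phi_pos: "t > 0 \<Longrightarrow> Phi p t = t powr (p - 1)"
  using powr_add[of t "p - 2" 1] by (simp add: Phi_def)

lemma abs_Phi: "\<bar>Phi p t\<bar> = \<bar>t\<bar> powr (p - 1)"
proof -
  have "\<bar>Phi p t\<bar> = Phi p \<bar>t\<bar>" by (simp add: Phi_def abs_mult)
  then show ?thesis by (cases "t = 0") (simp_all add: Phi_pos, simp add: Phi_def)
qed

lemma DERIV_Phi:
  assumes p: "p \<ge> 2"
  shows "(Phi p has_real_derivative (p - 1) * pweight p t) (at t)"
proof (cases "p = 2")
  case True
  have "Phi 2 = (\<lambda>t. t)" by (auto simp: Phi_def)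
  then show ?thesis using True by (simp add: pweight_def)
next
  case False
  then have p2: "p > 2" using p by simp
  consider "t > 0" | "t < 0" | "t = 0" by linarith
  then show ?thesis
  proof cases
    case 1
    have "((\<lambda>t. t powr (p - 1)) has_real_derivative (p - 1) * pweight p t) (at t)"
      using has_real_derivative_powr[OF 1, of "p - 1"] 1 False by (simp add: pweight_def)
    then show ?thesis
      by (rule has_field_derivative_transform_within_open[of _ _ _ "{0<..}"]) (use 1 in \<open>auto simp: Phi_pos\<close>)
  next
    case 2
    have *: "((\<lambda>t. - ((- t) powr (p - 1))) has_real_derivative (p - 1) * pweight p t) (at t)"
      using 2 False by (auto intro!: derivative_eq_intros simp: pweight_def)
    have **: "- ((- t) powr (p - 1)) = Phi p t" if "t < 0" for t
      using Phi_pos[of "- t" p] that by (simp add: Phi_uminus)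
    show ?thesis
      by (rule has_field_derivative_transform_within_open[OF *, of "{..<0}"]) (use 2 ** in auto)
  next
    case 3
    have "(pweight p \<longlongrightarrow> pweight p 0) (at 0)"
      using continuous_on_pweight[OF p, of UNIV] by (simp add: continuous_on_def)
    then have "(pweight p \<longlongrightarrow> 0) (at 0)" using p2 by (simp add: pweight_def)
    then have "((\<lambda>h. (Phi p (0 + h) - Phi p 0) / h) \<longlongrightarrow> 0) (at 0)"
      by (rule Lim_transform_eventually)
         (use False in \<open>auto simp: Phi_def pweight_def eventually_at_filter\<close>)
    then show ?thesis using 3 p2 by (simp add: DERIV_def pweight_def)
  qed
qed

lemma Phi_add_mvt:
  assumes p: "p \<ge> 2"
  obtains \<xi> where "min a (-b) \<le> \<xi>" "\<xi> \<le> max a (-b)" "Phi p a + Phi p b = (p - 1) * pweight p \<xi> * (a + b)"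
proof -
  consider "a = - b" | "a < - b" | "- b < a" by linarith
  then show thesis
  proof cases
    case 1
    then show thesis by (intro that[of a]) (simp_all add: Phi_uminus)
  next
    case 2
    from MVT2[OF 2 DERIV_Phi[OF p]] obtain z where "a < z" "z < -b"
      "Phi p (-b) - Phi p a = (-b - a) * ((p - 1) * pweight p z)" by blast
    then show thesis by (intro that[of z]) (simp_all add: Phi_uminus algebra_simps)
  next
    case 3
    from MVT2[OF 3 DERIV_Phi[OF p]] obtain z where "-b < z" "z < a"
      "Phi p a - Phi p (-b) = (a - - b) * ((p - 1) * pweight p z)" by blast
    then show thesis by (intro that[of z]) (simp_all add: Phi_uminus algebra_simps)
  qed
qed

lemma pweight_mono:
  assumes "p \<ge> 2" "\<bar>a\<bar> \<le> b"
  shows "pweight p a \<le> pweight p b"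
  using assms by (auto simp: pweight_def intro!: powr_mono2)

lemma pweight_mult_square: "p \<ge> 2 \<Longrightarrow> r \<ge> 0 \<Longrightarrow> pweight p r * r^2 = r powr p"
  by (cases "r = 0") (auto simp: pweight_def powr_diff)

lemma norm_matrix_vector_mult_le:
  fixes A :: "real^'n^'m"
  shows "norm (A *v x) \<le> norm A * norm x"
proof -
  have "\<bar>(A *v x) $ i\<bar> \<le> norm x * norm (A $ i)" for i
    using Cauchy_Schwarz_ineq2[of "A $ i" x] by (simp add: matrix_vector_mul_component mult.commute)
  then have "norm (A *v x) \<le> L2_set (\<lambda>i. norm x * norm (A $ i)) UNIV"
    unfolding norm_vec_def[of "A *v x"] by (intro L2_set_mono) auto
  also have "\<dots> = norm A * norm x"
    by (simp add: L2_set_right_distrib[symmetric] norm_vec_def mult.commute)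
  finally show ?thesis .
qed

definition symdiff :: "real \<Rightarrow> (real^'n \<Rightarrow> real) \<Rightarrow> real^'n \<Rightarrow> real^'n \<Rightarrow> real" where
  "symdiff p \<phi> x z = (Phi p (\<phi> x - \<phi> (x + z)) + Phi p (\<phi> x - \<phi> (x - z))) / 2"

context
  fixes \<phi> :: "real^'n \<Rightarrow> real" and G :: "real^'n \<Rightarrow> real^'n" and x :: "real^'n"
  assumes G: "\<And>y. GDERIV \<phi> y :> G y"
begin

lemma continuous_phi: "continuous_on UNIV \<phi>"
  using G by (meson GDERIV_DERIV_compose continuous_at_imp_continuous_on gderiv_def has_derivative_continuous)

lemma borel_measurable_symdiff: "symdiff p \<phi> x \<in> borel_measurable borel"
proof -
  have [measurable]: "\<phi> \<in> borel_measurable borel"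
    by (rule borel_measurable_continuous_onI[OF continuous_phi])
  show ?thesis unfolding symdiff_def[abs_def] Phi_def by measurable
qed

lemma DERIV_phi_line: "((\<lambda>h. \<phi> (x + h *\<^sub>R w)) has_real_derivative G (x + h *\<^sub>R w) \<bullet> w) (at h)"
proof -
  have "(\<phi> has_derivative (\<lambda>k. k \<bullet> G (x + h *\<^sub>R w))) (at (x + h *\<^sub>R w))"
    using G by (simp add: gderiv_def)
  then have "((\<lambda>h. \<phi> (x + h *\<^sub>R w)) has_derivative (\<lambda>k. (k *\<^sub>R w) \<bullet> G (x + h *\<^sub>R w))) (at h)"
    by (rule has_derivative_compose[rotated]) (auto intro!: derivative_eq_intros)
  then show ?thesis
    by (rule has_derivative_imp_has_field_derivative) (simp add: inner_commute mult.commute)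
qed

lemma first_difference_limit:
  "((\<lambda>h. (\<phi> x - \<phi> (x + h *\<^sub>R w)) / h) \<longlongrightarrow> - (G x \<bullet> w)) (at_right 0)"
proof -
  have "((\<lambda>h. (\<phi> (x + h *\<^sub>R w) - \<phi> x) / h) \<longlongrightarrow> G x \<bullet> w) (at 0)"
    using DERIV_phi_line[of w 0] by (simp add: DERIV_def)
  then have "((\<lambda>h. - ((\<phi> (x + h *\<^sub>R w) - \<phi> x) / h)) \<longlongrightarrow> - (G x \<bullet> w)) (at_right 0)"
    by (intro tendsto_minus) (rule tendsto_mono[OF at_le]; simp)
  then show ?thesis by (simp add: minus_divide_left)
qed

lemma DERIV_second_difference:
  "((\<lambda>h. \<phi> (x + h *\<^sub>R w) + \<phi> (x - h *\<^sub>R w) - 2 * \<phi> x) has_real_derivative (G (x + h *\<^sub>R w) - G (x - h *\<^sub>R w)) \<bullet> w) (at h)"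
  using DERIV_phi_line[of w h] DERIV_phi_line[of "- w" h]
  by (auto intro!: derivative_eq_intros simp: inner_diff_left)

context
  fixes H :: "real^'n \<Rightarrow> real^'n^'n"
  assumes H: "\<And>y. (G has_derivative (\<lambda>h. H y *v h)) (at y)"
begin

lemma second_difference_limit:
  "((\<lambda>h. (\<phi> (x + h *\<^sub>R w) + \<phi> (x - h *\<^sub>R w) - 2 * \<phi> x) / h^2) \<longlongrightarrow> w \<bullet> (H x *v w)) (at_right 0)"
proof (rule lhopital_right_0)
  let ?f = "\<lambda>h. \<phi> (x + h *\<^sub>R w) + \<phi> (x - h *\<^sub>R w) - 2 * \<phi> x"
  have "isCont ?f 0" by (rule DERIV_isCont[OF DERIV_second_difference])
  then have "(?f \<longlongrightarrow> 0) (at 0)" by (simp add: isCont_def)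
  then show "(?f \<longlongrightarrow> 0) (at_right 0)" by (rule tendsto_mono[OF at_le, rotated]) simp
  show "((\<lambda>h::real. h^2) \<longlongrightarrow> 0) (at_right 0)"
    by (auto intro!: tendsto_eq_intros)
  show "\<forall>\<^sub>F h::real in at_right 0. h^2 \<noteq> 0" "\<forall>\<^sub>F h::real in at_right 0. 2 * h \<noteq> 0"
    by (auto simp: eventually_at_filter)
  show "\<forall>\<^sub>F h in at_right 0. (?f has_real_derivative (G (x + h *\<^sub>R w) - G (x - h *\<^sub>R w)) \<bullet> w) (at h)"
    using DERIV_second_difference by simp
  show "\<forall>\<^sub>F h::real in at_right 0. ((\<lambda>h. h^2) has_real_derivative 2 * h) (at h)"
    by (auto intro!: always_eventually derivative_eq_intros)
  have line: "((\<lambda>h. G (x + h *\<^sub>R v) \<bullet> w) has_real_derivative (H x *v v) \<bullet> w) (at 0)" for v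
  proof -
    have "((\<lambda>h. G (x + h *\<^sub>R v)) has_derivative (\<lambda>k. H x *v (k *\<^sub>R v))) (at 0)"
      by (rule has_derivative_compose[of "\<lambda>h. x + h *\<^sub>R v" _ _ _ G]) (use H[of x] in \<open>auto intro!: derivative_eq_intros\<close>)
    from has_derivative_inner_left[OF this, of w] show ?thesis
      by (rule has_derivative_imp_has_field_derivative) (simp add: matrix_vector_mult_scaleR mult.commute)
  qed
  have "((\<lambda>h. (G (x + h *\<^sub>R w) \<bullet> w - G (x + h *\<^sub>R (- w)) \<bullet> w)) has_real_derivative (H x *v w) \<bullet> w - (H x *v (- w)) \<bullet> w) (at 0)"
    by (intro DERIV_diff line)
  then have T: "((\<lambda>h. (G (x + h *\<^sub>R w) - G (x - h *\<^sub>R w)) \<bullet> w / h) \<longlongrightarrow> 2 * (w \<bullet> (H x *v w))) (at 0)"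
    using matrix_vector_mult_diff_distrib[of "H x" 0 w]
    by (simp add: DERIV_def inner_diff_left inner_diff_right inner_commute)
  have "((\<lambda>h. (G (x + h *\<^sub>R w) - G (x - h *\<^sub>R w)) \<bullet> w / h / 2) \<longlongrightarrow> 2 * (w \<bullet> (H x *v w)) / 2) (at_right 0)"
    by (intro tendsto_divide tendsto_const tendsto_mono[OF at_le[OF subset_UNIV] T]) simp
  then show "((\<lambda>h. (G (x + h *\<^sub>R w) - G (x - h *\<^sub>R w)) \<bullet> w / (2 * h)) \<longlongrightarrow> w \<bullet> (H x *v w)) (at_right 0)"
    by (simp add: mult.commute)
qed

lemma symdiff_limit:
  assumes p: "p \<ge> 2"
  shows "((\<lambda>h. symdiff p \<phi> x (h *\<^sub>R w) / h powr p) \<longlongrightarrow> - ((p - 1) / 2 * pweight p (G x \<bullet> w) * (w \<bullet> (H x *v w)))) (at_right 0)"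
proof -
  let ?a = "\<lambda>h. \<phi> x - \<phi> (x + h *\<^sub>R w)" and ?b = "\<lambda>h. \<phi> x - \<phi> (x - h *\<^sub>R w)"
  have "\<exists>\<xi>. min (?a h) (- ?b h) \<le> \<xi> \<and> \<xi> \<le> max (?a h) (- ?b h) \<and>
      Phi p (?a h) + Phi p (?b h) = (p - 1) * pweight p \<xi> * (?a h + ?b h)" for h
    by (metis Phi_add_mvt[OF p])
  then obtain \<xi> where \<xi>: "min (?a h) (- ?b h) \<le> \<xi> h" "\<xi> h \<le> max (?a h) (- ?b h)"
      "Phi p (?a h) + Phi p (?b h) = (p - 1) * pweight p (\<xi> h) * (?a h + ?b h)" for h
    by metis
  have a: "((\<lambda>h. ?a h / h) \<longlongrightarrow> - (G x \<bullet> w)) (at_right 0)"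
    by (rule first_difference_limit)
  have b: "((\<lambda>h. - ?b h / h) \<longlongrightarrow> - (G x \<bullet> w)) (at_right 0)"
    using tendsto_minus[OF first_difference_limit[of "- w"]] by (simp add: minus_divide_left)
  have "((\<lambda>h. \<xi> h / h) \<longlongrightarrow> - (G x \<bullet> w)) (at_right 0)"
  proof (rule tendsto_sandwich)
    show "((\<lambda>h. min (?a h / h) (- ?b h / h)) \<longlongrightarrow> - (G x \<bullet> w)) (at_right 0)"
      using tendsto_min[OF a b] by simp
    show "((\<lambda>h. max (?a h / h) (- ?b h / h)) \<longlongrightarrow> - (G x \<bullet> w)) (at_right 0)"
      using tendsto_max[OF a b] by simp
    have pos: "\<forall>\<^sub>F h::real in at_right 0. h > 0" by (simp add: eventually_at_filter)
    show "\<forall>\<^sub>F h in at_right 0. min (?a h / h) (- ?b h / h) \<le> \<xi> h / h"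
      using pos
    proof eventually_elim
      case (elim h)
      then show ?case using divide_right_mono[OF \<xi>(1)[of h], of h] by (auto simp: min_def divide_le_cancel split: if_splits)
    qed
    show "\<forall>\<^sub>F h in at_right 0. \<xi> h / h \<le> max (?a h / h) (- ?b h / h)"
      using pos
    proof eventually_elim
      case (elim h)
      then show ?case using divide_right_mono[OF \<xi>(2)[of h], of h] by (auto simp: max_def divide_le_cancel split: if_splits)
    qed
  qed
  moreover have "isCont (pweight p) (- (G x \<bullet> w))"
    using continuous_on_pweight[OF p, of UNIV] by (simp add: continuous_on_eq_continuous_at)
  ultimately have "((\<lambda>h. pweight p (\<xi> h / h)) \<longlongrightarrow> pweight p (- (G x \<bullet> w))) (at_right 0)"
    by (rule isCont_tendsto_compose[rotated])
  then have "((\<lambda>h. (p - 1) / 2 * pweight p (\<xi> h / h) * - ((\<phi> (x + h *\<^sub>R w) + \<phi> (x - h *\<^sub>R w) - 2 * \<phi> x) / h^2))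
      \<longlongrightarrow> (p - 1) / 2 * pweight p (- (G x \<bullet> w)) * - (w \<bullet> (H x *v w))) (at_right 0)"
    by (intro tendsto_intros second_difference_limit)
  moreover have "\<forall>\<^sub>F h in at_right 0. (p - 1) / 2 * pweight p (\<xi> h / h) * - ((\<phi> (x + h *\<^sub>R w) + \<phi> (x - h *\<^sub>R w) - 2 * \<phi> x) / h^2)
      = symdiff p \<phi> x (h *\<^sub>R w) / h powr p"
  proof -
    have "\<forall>\<^sub>F h::real in at_right 0. h > 0" by (simp add: eventually_at_filter)
    then show ?thesis
    proof eventually_elim
      case (elim h)
      have hp: "h powr p = pweight p h * h^2" using pweight_mult_square[OF p, of h] elim by simp
      have "pweight p h \<noteq> 0" using elim by (simp add: pweight_def)
      moreover have "pweight p (\<xi> h) = pweight p h * pweight p (\<xi> h / h)"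
        using elim by (simp flip: pweight_mult)
      ultimately have "symdiff p \<phi> x (h *\<^sub>R w) / h powr p = (p - 1) / 2 * pweight p (\<xi> h / h) * ((?a h + ?b h) / h^2)"
        unfolding symdiff_def \<xi>(3) hp by simp
      also have "(?a h + ?b h) / h^2 = - ((\<phi> (x + h *\<^sub>R w) + \<phi> (x - h *\<^sub>R w) - 2 * \<phi> x) / h^2)"
        by (simp add: minus_divide_left)
      finally show ?case ..
    qed
  qed
  ultimately have "((\<lambda>h. symdiff p \<phi> x (h *\<^sub>R w) / h powr p) \<longlongrightarrow> (p - 1) / 2 * pweight p (- (G x \<bullet> w)) * - (w \<bullet> (H x *v w))) (at_right 0)"
    by (rule Lim_transform_eventually)
  moreover have "pweight p (- (G x \<bullet> w)) = pweight p (G x \<bullet> w)"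
    by (simp only: pweight_def abs_minus_cancel)
  ultimately show ?thesis by simp
qed

lemma symdiff_bound:
  assumes bdd: "bounded (range \<phi>)" "bounded (range G)" "bounded (range H)" and P: "P \<ge> 2"
  obtains M where "M \<ge> 0" "\<And>p z. 2 \<le> p \<Longrightarrow> p \<le> P \<Longrightarrow> \<bar>symdiff p \<phi> x z\<bar> \<le> M * min 1 (norm z powr p)"
proof -
  obtain B0 where B0: "\<And>y. \<bar>\<phi> y\<bar> \<le> B0" using bdd(1) by (auto simp: bounded_iff)
  obtain B1 where B1: "B1 \<ge> 1" "\<And>y. norm (G y) \<le> B1"
    using bdd(2) by (auto simp: bounded_iff) (metis max.coboundedI1 max.cobounded2)
  obtain L where L: "\<And>y. norm (H y) \<le> L" using bdd(3) by (auto simp: bounded_iff)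
  have L0: "L \<ge> 0" using L[of 0] norm_ge_zero order_trans by blast
  define A where "A = max 1 (2 * B0)"
  have A: "A \<ge> 1" "2 * B0 \<le> A" by (auto simp: A_def)
  have lip: "\<bar>\<phi> (x + z) - \<phi> x\<bar> \<le> B1 * norm z" for z
  proof -
    have "norm (\<phi> (x + z) - \<phi> x) \<le> B1 * norm ((x + z) - x)"
    proof (rule differentiable_bound[of UNIV \<phi> "\<lambda>y k. k \<bullet> G y"])
      show "onorm (\<lambda>k. k \<bullet> G y) \<le> B1" for y
      proof (rule onorm_bound)
        show "norm (k \<bullet> G y) \<le> B1 * norm k" for k
          using Cauchy_Schwarz_ineq2[of k "G y"] mult_left_mono[OF B1(2)[of y], of "norm k"] by (simp add: mult.commute)
      qed (use B1(1) in simp)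
    qed (use G in \<open>auto simp: gderiv_def\<close>)
    then show ?thesis by simp
  qed
  have Glip: "norm (G y - G y') \<le> L * norm (y - y')" for y y'
  proof (rule differentiable_bound[of UNIV G "\<lambda>y h. H y *v h"])
    show "onorm ((*v) (H y)) \<le> L" for y
      using L0 by (intro onorm_bound order_trans[OF norm_matrix_vector_mult_le] mult_right_mono L) auto
  qed (use H in auto)
  have second: "\<bar>\<phi> (x + z) + \<phi> (x - z) - 2 * \<phi> x\<bar> \<le> 2 * L * (norm z)^2" for z
  proof -
    obtain u :: real where u: "0 < u" "u < 1"
      "\<phi> (x + 1 *\<^sub>R z) + \<phi> (x - 1 *\<^sub>R z) - 2 * \<phi> x - (\<phi> (x + 0 *\<^sub>R z) + \<phi> (x - 0 *\<^sub>R z) - 2 * \<phi> x)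
        = (1 - 0) * ((G (x + u *\<^sub>R z) - G (x - u *\<^sub>R z)) \<bullet> z)"
      using MVT2[of 0 1 "\<lambda>h. \<phi> (x + h *\<^sub>R z) + \<phi> (x - h *\<^sub>R z) - 2 * \<phi> x", OF _ DERIV_second_difference] by auto
    have "\<bar>(G (x + u *\<^sub>R z) - G (x - u *\<^sub>R z)) \<bullet> z\<bar> \<le> norm (G (x + u *\<^sub>R z) - G (x - u *\<^sub>R z)) * norm z"
      by (rule Cauchy_Schwarz_ineq2)
    also have "\<dots> \<le> (L * norm ((x + u *\<^sub>R z) - (x - u *\<^sub>R z))) * norm z"
      by (intro mult_right_mono Glip) auto
    also have "(x + u *\<^sub>R z) - (x - u *\<^sub>R z) = (2 * u) *\<^sub>R z"
      by (simp add: algebra_simps flip: scaleR_add_left)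
    also have "(L * norm ((2 * u) *\<^sub>R z)) * norm z = u * (2 * L * (norm z)^2)"
      using u by (simp add: power2_eq_square)
    also have "\<dots> \<le> 1 * (2 * L * (norm z)^2)"
      using u L0 by (intro mult_right_mono) auto
    finally show ?thesis using u(3) by simp
  qed
  define M where "M = (P - 1) * B1 powr (P - 2) * L + A powr (P - 1)"
  have M: "(P - 1) * B1 powr (P - 2) * L \<le> M" "A powr (P - 1) \<le> M"
    using P L0 by (auto simp: M_def)
  show thesis
  proof (rule that[of M])
    show "M \<ge> 0" using P L0 by (simp add: M_def)
  next
    fix p z assume p: "2 \<le> p" "p \<le> P"
    let ?a = "\<phi> x - \<phi> (x + z)" and ?b = "\<phi> x - \<phi> (x - z)"
    have bd: "\<bar>Phi p (\<phi> x - \<phi> y)\<bar> \<le> A powr (P - 1)" for y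
    proof -
      have "\<bar>\<phi> x - \<phi> y\<bar> \<le> A" using B0[of x] B0[of y] A(2) by linarith
      then have "\<bar>\<phi> x - \<phi> y\<bar> powr (p - 1) \<le> A powr (p - 1)" using p by (intro powr_mono2) auto
      also have "\<dots> \<le> A powr (P - 1)" using p A by (intro powr_mono) auto
      finally show ?thesis using p by (simp add: abs_Phi)
    qed
    have "\<bar>symdiff p \<phi> x z\<bar> \<le> A powr (P - 1)"
    proof -
      have "\<bar>symdiff p \<phi> x z\<bar> = \<bar>Phi p ?a + Phi p ?b\<bar> / 2" by (simp add: symdiff_def)
      also have "\<dots> \<le> (\<bar>Phi p ?a\<bar> + \<bar>Phi p ?b\<bar>) / 2"
        by (intro divide_right_mono abs_triangle_ineq) simp
      also have "\<dots> \<le> (A powr (P - 1) + A powr (P - 1)) / 2"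
        by (intro divide_right_mono add_mono bd) simp
      finally show ?thesis by simp
    qed
    moreover have "\<bar>symdiff p \<phi> x z\<bar> \<le> (P - 1) * B1 powr (P - 2) * L * norm z powr p"
    proof -
      obtain \<xi> where \<xi>: "min ?a (- ?b) \<le> \<xi>" "\<xi> \<le> max ?a (- ?b)"
        "Phi p ?a + Phi p ?b = (p - 1) * pweight p \<xi> * (?a + ?b)"
        using Phi_add_mvt[OF p(1)] by metis
      have "\<bar>\<xi>\<bar> \<le> B1 * norm z" using lip[of z] lip[of "- z"] \<xi>(1,2) by auto
      then have "pweight p \<xi> \<le> pweight p (B1 * norm z)" by (rule pweight_mono[OF p(1)])
      also have "\<dots> = pweight p B1 * pweight p (norm z)" by (rule pweight_mult)
      also have "\<dots> \<le> B1 powr (P - 2) * pweight p (norm z)"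
        using p B1(1) by (intro mult_right_mono pweight_nonneg)
          (auto simp: pweight_def ge_one_powr_ge_zero intro!: powr_mono)
      finally have w: "pweight p \<xi> \<le> B1 powr (P - 2) * pweight p (norm z)" .
      have ab: "\<bar>?a + ?b\<bar> \<le> 2 * L * (norm z)^2" using second[of z] by linarith
      have "\<bar>symdiff p \<phi> x z\<bar> = (p - 1) / 2 * pweight p \<xi> * \<bar>?a + ?b\<bar>"
        using p pweight_nonneg[of p \<xi>] unfolding symdiff_def \<xi>(3) by (simp add: abs_mult)
      also have "\<dots> \<le> (P - 1) / 2 * (B1 powr (P - 2) * pweight p (norm z)) * (2 * L * (norm z)^2)"
        using p by (intro mult_mono w ab) (auto simp: pweight_nonneg)
      also have "\<dots> = (P - 1) * B1 powr (P - 2) * L * (pweight p (norm z) * (norm z)^2)" by simp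
      also have "\<dots> = (P - 1) * B1 powr (P - 2) * L * norm z powr p"
        using p by (simp add: pweight_mult_square)
      finally show ?thesis .
    qed
    moreover have "(P - 1) * B1 powr (P - 2) * L * norm z powr p \<le> M * norm z powr p"
      by (intro mult_right_mono M) auto
    ultimately show "\<bar>symdiff p \<phi> x z\<bar> \<le> M * min 1 (norm z powr p)"
      using M(2) by (auto simp: min_def)
  qed
qed

end

end

section \<open>The two limits\<close>

lemma has_derivative_powr_scaleR:
  fixes g e :: "real^'n"
  assumes p: "p \<ge> 2" and e: "norm e = 1" "g = norm g *\<^sub>R e"
  shows "((\<lambda>v. norm v powr (p - 2) *\<^sub>R v) has_derivative (\<lambda>v. pweight p (norm g) *\<^sub>R (v + ((p - 2) * (e \<bullet> v)) *\<^sub>R e))) (at g)"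
proof (cases "p = 2")
  case True
  have "(\<lambda>v::real^'n. norm v powr (2 - 2) *\<^sub>R v) = (\<lambda>v. v)" by auto
  then show ?thesis using True by (simp add: pweight_def)
next
  case False
  then have p2: "p > 2" using p by simp
  show ?thesis
  proof (cases "g = 0")
    case True
    have "((\<lambda>t::real^'n. pweight p (norm t)) \<longlongrightarrow> pweight p (norm (0::real^'n))) (at 0)"
      using continuous_on_pweight[OF p, of UNIV]
      by (intro isCont_tendsto_compose[where g="pweight p", OF _ tendsto_norm[OF tendsto_ident_at]]) (simp add: continuous_on_eq_continuous_at)
    then have "((\<lambda>h::real^'n. norm (norm (0 + h) powr (p - 2) *\<^sub>R (0 + h) - norm (0::real^'n) powr (p - 2) *\<^sub>R 0 - 0) / norm h) \<longlongrightarrow> 0) (at 0)"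
      using False by (auto simp: pweight_def elim!: Lim_transform_eventually intro!: eventually_at_filter[THEN iffD2] always_eventually)
    then have "((\<lambda>v::real^'n. norm v powr (p - 2) *\<^sub>R v) has_derivative (\<lambda>v. 0)) (at 0)"
      by (simp add: has_derivative_at)
    then show ?thesis using True False by (simp add: pweight_def)
  next
    case g: False
    have "((\<lambda>v. norm v powr (p - 2)) has_derivative (\<lambda>v. (sgn g \<bullet> v) * ((p - 2) * norm g powr (p - 2 - 1)))) (at g)"
    proof (rule DERIV_compose_FDERIV[where f="\<lambda>t. t powr (p - 2)" and g=norm])
      show "((\<lambda>t. t powr (p - 2)) has_real_derivative (p - 2) * norm g powr (p - 2 - 1)) (at (norm g))"
        by (rule has_real_derivative_powr) (use g in simp)
      show "(norm has_derivative (\<lambda>v. sgn g \<bullet> v)) (at g)"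
        using has_derivative_norm[OF g] by (simp add: inner_commute)
    qed
    then have D: "((\<lambda>v. norm v powr (p - 2) *\<^sub>R v) has_derivative
        (\<lambda>v. norm g powr (p - 2) *\<^sub>R v + ((sgn g \<bullet> v) * ((p - 2) * norm g powr (p - 2 - 1))) *\<^sub>R g)) (at g)"
      by (rule has_derivative_scaleR[OF _ has_derivative_ident])
    have E: "(\<lambda>v. norm g powr (p - 2) *\<^sub>R v + ((sgn g \<bullet> v) * ((p - 2) * norm g powr (p - 2 - 1))) *\<^sub>R g)
          = (\<lambda>v. pweight p (norm g) *\<^sub>R (v + ((p - 2) * (e \<bullet> v)) *\<^sub>R e))"
    proof -
      have s: "sgn g = e" using e g by (metis sgn_div_norm scaleR_scaleR left_inverse norm_eq_zero scaleR_one)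
      have "norm g powr (p - 3) * norm g = norm g powr (p - 2)"
        using g powr_add[of "norm g" "p - 3" 1] by simp
      then have w: "x * (norm g powr (p - 3) * norm g) = x * norm g powr (p - 2)" for x by simp
      have "((e \<bullet> v) * ((p - 2) * norm g powr (p - 3))) *\<^sub>R g = (norm g powr (p - 2) * ((p - 2) * (e \<bullet> v))) *\<^sub>R e" for v
      proof -
        have "((e \<bullet> v) * ((p - 2) * norm g powr (p - 3))) *\<^sub>R g = ((e \<bullet> v) * ((p - 2) * norm g powr (p - 3))) *\<^sub>R (norm g *\<^sub>R e)"
          using e(2) by simp
        also have "\<dots> = (((e \<bullet> v) * (p - 2)) * (norm g powr (p - 3) * norm g)) *\<^sub>R e"
          by (simp add: mult.assoc)
        finally show ?thesis unfolding w by (simp add: mult_ac)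
      qed
      then show ?thesis
        using False by (simp add: s pweight_def scaleR_add_right)
    qed
    show ?thesis using D unfolding E .
  qed
qed

lemma tendsto_Phi_exponent: "((\<lambda>p. Phi p t) \<longlongrightarrow> Phi 2 t) (at_right 2)"
proof (cases "t = 0")
  case False
  then show ?thesis unfolding Phi_def by (intro tendsto_intros) auto
qed (simp add: Phi_def)

context
  fixes \<phi> :: "real^'n \<Rightarrow> real" and G :: "real^'n \<Rightarrow> real^'n" and H :: "real^'n \<Rightarrow> real^'n^'n"
    and x :: "real^'n"
  assumes G: "\<And>y. GDERIV \<phi> y :> G y"
    and H: "\<And>y. (G has_derivative (\<lambda>h. H y *v h)) (at y)"
begin

lemma grad_eq: "grad \<phi> y = G y"
  unfolding grad_def
proof (rule the_equality)
  fix D assume "GDERIV \<phi> y :> D"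
  then have "(\<lambda>h. h \<bullet> D) = (\<lambda>h. h \<bullet> G y)"
    using G[of y] unfolding gderiv_def by (rule has_derivative_unique)
  then show "D = G y" by (metis vector_eq_ldot)
qed (rule G)

lemma p_laplacian_eq:
  assumes p: "p \<ge> 2" and e: "norm e = 1" "G x = norm (G x) *\<^sub>R e"
  shows "p_laplacian p \<phi> x = pweight p (norm (G x)) * (trace (H x) + (p - 2) * (e \<bullet> (H x *v e)))"
proof -
  define D where "D h = pweight p (norm (G x)) *\<^sub>R (H x *v h + ((p - 2) * (e \<bullet> (H x *v h))) *\<^sub>R e)" for h
  have "((\<lambda>y. norm (G y) powr (p - 2) *\<^sub>R G y) has_derivative D) (at x)"
    unfolding D_def
    by (rule has_derivative_compose[OF H has_derivative_powr_scaleR[OF p e]])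
  then have "frechet_derivative (\<lambda>y. norm (G y) powr (p - 2) *\<^sub>R G y) (at x) = D"
    by (rule frechet_derivative_at[symmetric])
  then have "p_laplacian p \<phi> x = (\<Sum>i\<in>UNIV. D (axis i 1) $ i)"
    by (simp add: p_laplacian_def divergence_def jacobian_def grad_eq trace_def matrix_def)
  also have "\<dots> = (\<Sum>i\<in>UNIV. pweight p (norm (G x)) * (H x $ i $ i + (p - 2) * (\<Sum>k\<in>UNIV. H x $ k $ i * (e $ k * e $ i))))"
    by (simp add: D_def matrix_vector_mult_basis column_def inner_vec_def sum_distrib_left sum_distrib_right mult_ac)
  also have "\<dots> = pweight p (norm (G x)) * (trace (H x) + (p - 2) * (\<Sum>i\<in>UNIV. \<Sum>k\<in>UNIV. H x $ k $ i * (e $ k * e $ i)))"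
    by (simp only: sum_distrib_left[symmetric] sum.distrib trace_def)
  also have "(\<Sum>i\<in>UNIV. \<Sum>k\<in>UNIV. H x $ k $ i * (e $ k * e $ i)) = e \<bullet> (H x *v e)"
    unfolding inner_matrix_vector_sum by (rule sum.swap)
  finally show ?thesis .
qed

context
  assumes bdd: "bounded (range \<phi>)" "bounded (range G)" "bounded (range H)"
begin

lemma integrable_symdiff:
  assumes p: "p \<ge> 2" and s: "0 < s" "s < 1"
  shows "integrable lborel (\<lambda>z. symdiff p \<phi> x z / norm z powr (real CARD('n) + s * p))"
proof -
  obtain M where M: "M \<ge> 0" "\<And>q z. 2 \<le> q \<Longrightarrow> q \<le> p \<Longrightarrow> \<bar>symdiff q \<phi> x z\<bar> \<le> M * min 1 (norm z powr q)"
    using symdiff_bound[where x=x, OF G H bdd p] by metis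
  show ?thesis
    by (rule integrable_fractional_kernel[OF borel_measurable_symdiff[OF G] _ s M(1) M(2)]) (use p in auto)
qed

lemma truncated_integral_symdiff:
  assumes p: "p \<ge> 2" and s: "0 < s" "s < 1" and eps: "\<epsilon> > 0"
  shows "(LINT y:{y. norm (x - y) > \<epsilon>}|lborel. Phi p (\<phi> x - \<phi> y) / norm (x - y) powr (real CARD('n) + s * p))
    = (\<integral>z. indicator {z. norm z > \<epsilon>} z * (symdiff p \<phi> x z / norm z powr (real CARD('n) + s * p)) \<partial>lborel)"
proof -
  define K where "K z = norm z powr (real CARD('n) + s * p)" for z :: "real^'n"
  define A where "A = {z::real^'n. norm z > \<epsilon>}"
  have [measurable]: "A \<in> sets borel" unfolding A_def by measurable
  have [measurable]: "K \<in> borel_measurable borel" unfolding K_def by measurable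
  have [measurable]: "\<phi> \<in> borel_measurable borel"
    by (rule borel_measurable_continuous_onI[OF continuous_phi[OF G]])
  have [measurable]: "Phi p \<in> borel_measurable borel" unfolding Phi_def[abs_def] by measurable
  define S where "S z = indicator A z * Phi p (\<phi> x - \<phi> (x + z))" for z
  have [measurable]: "S \<in> borel_measurable borel" unfolding S_def by measurable
  obtain B0 where B0: "\<And>y. \<bar>\<phi> y\<bar> \<le> B0" using bdd(1) by (auto simp: bounded_iff)
  define \<mu> where "\<mu> = min 1 (\<epsilon> powr p)"
  have mn: "\<mu> > 0" using eps by (simp add: \<mu>_def)
  define B where "B = (2 * B0) powr (p - 1) / \<mu>"
  have Sb: "\<bar>S z\<bar> \<le> B * min 1 (norm z powr p)" for z
  proof (cases "z \<in> A")
    case True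
    have "\<bar>\<phi> x - \<phi> (x + z)\<bar> \<le> 2 * B0" using B0[of x] B0[of "x + z"] by linarith
    then have "\<bar>S z\<bar> \<le> (2 * B0) powr (p - 1)"
      using True p by (simp add: S_def abs_Phi powr_mono2)
    also have "\<dots> = B * \<mu>" using mn by (simp add: B_def)
    also have "\<dots> \<le> B * min 1 (norm z powr p)"
      unfolding \<mu>_def
    proof (intro mult_left_mono min.mono order_refl powr_mono2)
      show "B \<ge> 0" using mn by (simp add: B_def)
    qed (use True p eps in \<open>auto simp: A_def\<close>)
    finally show ?thesis .
  qed (use mn in \<open>auto simp: S_def B_def\<close>)
  have Sint: "integrable lborel (\<lambda>z. S z / K z)"
    unfolding K_def by (rule integrable_fractional_kernel[OF _ _ s _ Sb]) (use p mn in \<open>auto simp: B_def\<close>)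
  have neg: "orthogonal_transformation (\<lambda>z::real^'n. - z)"
    using orthogonal_transformation_neg[of "\<lambda>z::real^'n. z"] by (simp add: orthogonal_transformation_id)
  have SintN: "integrable lborel (\<lambda>z. S (- z) / K (- z))"
  proof -
    have "integrable (distr lborel borel (\<lambda>z::real^'n. - z)) (\<lambda>z. S z / K z)"
      unfolding lborel_distr_orthogonal[OF neg] by (rule Sint)
    then show ?thesis by (subst (asm) integrable_distr_eq) measurable
  qed
  have "(LINT y:{y. norm (x - y) > \<epsilon>}|lborel. Phi p (\<phi> x - \<phi> y) / norm (x - y) powr (real CARD('n) + s * p))
      = (\<integral>y. S (y - x) / K (y - x) \<partial>lborel)"
    unfolding set_lebesgue_integral_def S_def K_def A_def
    by (intro Bochner_Integration.integral_cong) (auto simp: indicator_def norm_minus_commute)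
  also have "\<dots> = (\<integral>y. S (y - x) / K (y - x) \<partial>(distr lborel borel ((+) x)))"
    by (simp only: lborel_distr_plus)
  also have "\<dots> = (\<integral>z. S z / K z \<partial>lborel)"
    by (subst integral_distr) simp_all
  also have "\<dots> = ((\<integral>z. S z / K z \<partial>lborel) + (\<integral>z. S (- z) / K (- z) \<partial>lborel)) / 2"
    using integral_lborel_orthogonal[OF neg, of "\<lambda>z. S z / K z"] by simp
  also have "\<dots> = (\<integral>z. (S z / K z + S (- z) / K (- z)) / 2 \<partial>lborel)"
    using Sint SintN by simp
  also have "\<dots> = (\<integral>z. indicator A z * (symdiff p \<phi> x z / K z) \<partial>lborel)"
    by (intro Bochner_Integration.integral_cong) (auto simp: S_def K_def A_def symdiff_def indicator_def add_divide_distrib)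
  finally show ?thesis by (simp add: K_def A_def)
qed

lemma PV_eq:
  assumes p: "p \<ge> 2" and s: "0 < s" "s < 1"
  shows "PV x (\<lambda>y. Phi p (\<phi> x - \<phi> y) / norm (x - y) powr (real CARD('n) + s * p))
    = (\<integral>z. symdiff p \<phi> x z / norm z powr (real CARD('n) + s * p) \<partial>lborel)"
proof -
  define I where "I z = symdiff p \<phi> x z / norm z powr (real CARD('n) + s * p)" for z
  have Iint: "integrable lborel I" unfolding I_def by (rule integrable_symdiff[OF p s])
  have [measurable]: "I \<in> borel_measurable borel" using Iint by (simp add: borel_measurable_integrable)
  have I0: "I 0 = 0" by (simp add: I_def symdiff_def Phi_def)
  have "((\<lambda>\<epsilon>. \<integral>z. indicator {z. norm z > \<epsilon>} z * I z \<partial>lborel) \<longlongrightarrow> (\<integral>z. I z \<partial>lborel)) (at_right 0)"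
  proof (rule integral_dominated_convergence_within)
    show "integrable lborel (\<lambda>z. \<bar>I z\<bar>)" using Iint by simp
    show "((\<lambda>\<epsilon>. indicator {z. norm z > \<epsilon>} z * I z) \<longlongrightarrow> I z) (at_right 0)" for z
    proof (cases "z = 0")
      case False
      then have "\<forall>\<^sub>F \<epsilon> in at_right 0. \<epsilon> < norm z"
        using eventually_at_right_real[of 0 "norm z"] by (auto elim: eventually_mono)
      then have "\<forall>\<^sub>F \<epsilon> in at_right 0. I z = indicator {z. norm z > \<epsilon>} z * I z"
        by eventually_elim simp
      then show ?thesis by (rule Lim_transform_eventually[OF tendsto_const])
    qed (simp add: I0)
    show "\<forall>\<^sub>F \<epsilon> in at_right 0. \<forall>z. norm (indicator {z. norm z > \<epsilon>} z * I z) \<le> \<bar>I z\<bar>"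
      by (auto simp: indicator_def)
  qed measurable
  then have "((\<lambda>\<epsilon>. LINT y:{y. norm (x - y) > \<epsilon>}|lborel. Phi p (\<phi> x - \<phi> y) / norm (x - y) powr (real CARD('n) + s * p))
      \<longlongrightarrow> (\<integral>z. I z \<partial>lborel)) (at_right 0)"
    by (rule Lim_transform_eventually)
       (auto simp: eventually_at_filter truncated_integral_symdiff[OF p s] I_def)
  then show ?thesis
    unfolding PV_def I_def[symmetric] by (intro tendsto_Lim) simp_all
qed

lemma tendsto_PV_exponent:
  assumes s: "0 < s" "s < 1"
  shows "((\<lambda>p. \<integral>z. symdiff p \<phi> x z / norm z powr (real CARD('n) + s * p) \<partial>lborel)
    \<longlongrightarrow> (\<integral>z. symdiff 2 \<phi> x z / norm z powr (real CARD('n) + s * 2) \<partial>lborel)) (at_right 2)"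
proof -
  obtain M where M: "M \<ge> 0" "\<And>p z. 2 \<le> p \<Longrightarrow> p \<le> 3 \<Longrightarrow> \<bar>symdiff p \<phi> x z\<bar> \<le> M * min 1 (norm z powr p)"
    using symdiff_bound[where x=x, OF G H bdd, of 3] by auto
  note [measurable] = borel_measurable_symdiff[OF G]
  show ?thesis
  proof (rule integral_dominated_convergence_within)
    show "integrable lborel (\<lambda>z::real^'n. (M * min 1 (norm z powr 2)) / norm z powr (real CARD('n) + s * 2))"
      by (rule integrable_fractional_kernel[of _ 2 s M]) (use s M(1) in auto)
    show "((\<lambda>p. symdiff p \<phi> x z / norm z powr (real CARD('n) + s * p))
        \<longlongrightarrow> symdiff 2 \<phi> x z / norm z powr (real CARD('n) + s * 2)) (at_right 2)" for z
    proof (cases "z = 0")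
      case True
      then have "symdiff p \<phi> x z = 0" for p by (simp add: symdiff_def Phi_def)
      then show ?thesis by simp
    next
      case False
      then show ?thesis unfolding symdiff_def
        by (intro tendsto_intros tendsto_Phi_exponent) auto
    qed
    have "\<forall>\<^sub>F p in at_right 2. p > 2 \<and> p < (3::real)"
      using eventually_at_right_real[of 2 3] by (auto elim: eventually_mono)
    then show "\<forall>\<^sub>F p in at_right 2. \<forall>z. norm (symdiff p \<phi> x z / norm z powr (real CARD('n) + s * p))
        \<le> (M * min 1 (norm z powr 2)) / norm z powr (real CARD('n) + s * 2)"
    proof eventually_elim
      case (elim p)
      show ?case
      proof
        fix z :: "real^'n"
        show "norm (symdiff p \<phi> x z / norm z powr (real CARD('n) + s * p))
          \<le> (M * min 1 (norm z powr 2)) / norm z powr (real CARD('n) + s * 2)"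
        proof (cases "z = 0")
          case False
          then have r: "norm z > 0" by simp
          have "min 1 (norm z powr p) / norm z powr (real CARD('n) + s * p) \<le> min 1 (norm z powr 2) / norm z powr (real CARD('n) + s * 2)"
          proof (cases "norm z \<le> 1")
            case True
            have m: "min 1 (norm z powr q) = norm z powr q" if "q > 0" for q
              using True that r powr_mono'[of 0 q "norm z"] by simp
            have "2 * (1 - s) \<le> p * (1 - s)" using elim s by (intro mult_right_mono) auto
            then have "norm z powr (p - (real CARD('n) + s * p)) \<le> norm z powr (2 - (real CARD('n) + s * 2))"
              using True r by (intro powr_mono') (auto simp: algebra_simps)
            moreover have "p > 0" using elim by simp
            ultimately show ?thesis by (simp only: m powr_diff zero_less_numeral)
          next
            case False
            have m: "min 1 (norm z powr q) = 1" if "q > 0" for q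
              using False that powr_mono[of 0 q "norm z"] r by simp
            have "norm z powr (real CARD('n) + s * 2) \<le> norm z powr (real CARD('n) + s * p)"
              using False elim s by (intro powr_mono) auto
            moreover have "p > 0" using elim by simp
            ultimately show ?thesis using r by (simp only: m zero_less_numeral) (intro frac_le; simp)
          qed
          then have "M * (min 1 (norm z powr p) / norm z powr (real CARD('n) + s * p)) \<le> M * (min 1 (norm z powr 2) / norm z powr (real CARD('n) + s * 2))"
            using M(1) by (rule mult_left_mono)
          moreover have "norm (symdiff p \<phi> x z / norm z powr (real CARD('n) + s * p)) \<le> (M * min 1 (norm z powr p)) / norm z powr (real CARD('n) + s * p)"
            using M(2)[of p z] elim by (simp add: divide_right_mono)
          ultimately show ?thesis by simp
        qed (simp add: symdiff_def Phi_def)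
      qed
    qed
  qed measurable
qed

lemma frac_p_laplacian_eq:
  assumes "p \<ge> 2" "0 < s" "s < 1"
  shows "frac_p_laplacian s p \<phi> x = C1 CARD('n) s p * (\<integral>z. symdiff p \<phi> x z / norm z powr (real CARD('n) + s * p) \<partial>lborel)"
  unfolding frac_p_laplacian_def using PV_eq[OF assms] by simp

lemma tendsto_frac_p_laplacian_exponent:
  assumes s: "0 < s" "s < 1"
  shows "((\<lambda>p. frac_p_laplacian s p \<phi> x) \<longlongrightarrow> frac_laplacian s \<phi> x) (at_right 2)"
proof -
  have G32: "Gamma (3 / 2 :: real) = sqrt pi / 2"
  proof -
    have "(1 / 2 :: real) \<notin> \<int>\<^sub>\<le>\<^sub>0" by (auto dest: nonpos_Ints_nonpos)
    then show ?thesis using Gamma_plus1[of "1 / 2 :: real"] by (simp add: Gamma_one_half_real)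
  qed
  have "C1 CARD('n) s 2 = c_frac CARD('n) s"
  proof -
    have "pi powr (real CARD('n) / 2) = pi powr ((real CARD('n) - 1) / 2) * sqrt pi"
      by (simp add: powr_half_sqrt[symmetric] diff_divide_distrib flip: powr_add)
    then show ?thesis
      unfolding c_frac_alt[OF s] C1_def powr_diff by (simp add: G32 mult_ac)
  qed
  moreover have "((\<lambda>p. C1 CARD('n) s p) \<longlongrightarrow> C1 CARD('n) s 2) (at_right 2)"
    unfolding C1_def
    by (intro tendsto_intros) (use s in \<open>auto dest!: nonpos_Ints_nonpos simp: G32 Gamma_eq_zero_iff\<close>)
  ultimately have lim: "((\<lambda>p. C1 CARD('n) s p * (\<integral>z. symdiff p \<phi> x z / norm z powr (real CARD('n) + s * p) \<partial>lborel))
      \<longlongrightarrow> c_frac CARD('n) s * (\<integral>z. symdiff 2 \<phi> x z / norm z powr (real CARD('n) + s * 2) \<partial>lborel)) (at_right 2)"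
    by (intro tendsto_mult tendsto_PV_exponent s) simp
  have eq: "frac_laplacian s \<phi> x = c_frac CARD('n) s * (\<integral>z. symdiff 2 \<phi> x z / norm z powr (real CARD('n) + s * 2) \<partial>lborel)"
  proof -
    have "Phi 2 t = t" for t by (simp add: Phi_def)
    then show ?thesis
      unfolding frac_laplacian_def using PV_eq[OF order_refl s] by (simp add: mult.commute)
  qed
  have "\<forall>\<^sub>F p in at_right 2. C1 CARD('n) s p * (\<integral>z. symdiff p \<phi> x z / norm z powr (real CARD('n) + s * p) \<partial>lborel) = frac_p_laplacian s p \<phi> x"
    by (auto simp: eventually_at_filter frac_p_laplacian_eq s)
  then show ?thesis unfolding eq by (rule Lim_transform_eventually[OF lim])
qed

lemma tendsto_frac_p_laplacian_order:
  assumes p: "p \<ge> 2"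
  shows "((\<lambda>s. frac_p_laplacian s p \<phi> x) \<longlongrightarrow> - p_laplacian p \<phi> x) (at_left 1)"
proof -
  obtain e where e: "norm e = 1" "G x = norm (G x) *\<^sub>R e"
  proof (cases "G x = 0")
    case True
    obtain k :: 'n where True by simp
    show thesis by (rule that[of "axis k 1"]) (simp_all add: True)
  next
    case False
    show thesis by (rule that[of "sgn (G x)"]) (simp_all add: False norm_sgn sgn_div_norm)
  qed
  let ?S = "symdiff p \<phi> x"
  obtain M where M: "M \<ge> 0" "\<And>z. \<bar>?S z\<bar> \<le> M * min 1 (norm z powr p)"
    using symdiff_bound[where x=x, OF G H bdd p] p by (metis order_refl)
  note S [measurable] = borel_measurable_symdiff[OF G, where p=p and x=x]
  have p0: "p \<ge> 0" "p > 0" using p by auto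
  obtain C where C: "C \<ge> 0" and bound: "\<And>R t. (R :: real^'n \<Rightarrow> real) \<in> borel_measurable borel
      \<Longrightarrow> (\<And>z. \<bar>R z\<bar> \<le> M * min 1 (norm z powr p)) \<Longrightarrow> t > 0 \<Longrightarrow> \<bar>gauss_dilation R t\<bar> \<le> C * min 1 (t powr (- p / 2))"
    using gauss_dilation_bound[OF p0(1) M(1)] by metis
  note dil = bound[OF S M(2)]
  define Q where "Q w = - ((p - 1) / 2 * pweight p (G x \<bullet> w) * (w \<bullet> (H x *v w)))" for w
  define m where "m = (\<integral>w. exp (- ((norm w)^2)) * Q w \<partial>lborel)"
  have [measurable]: "(\<lambda>w. H x *v w) \<in> borel_measurable borel"
    by (intro borel_measurable_continuous_onI linear_continuous_on matrix_vector_mul_bounded_linear)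
  have [measurable]: "Q \<in> borel_measurable borel" unfolding Q_def by measurable
  have "((\<lambda>t. t powr (p / 2) * gauss_dilation ?S t) \<longlongrightarrow> m) at_top"
    unfolding m_def
  proof (rule gauss_dilation_limit[OF S _ p0(1)])
    show "((\<lambda>h. ?S (h *\<^sub>R w) / h powr p) \<longlongrightarrow> Q w) (at_right 0)" for w
      unfolding Q_def by (rule symdiff_limit[OF G H p])
    show "\<bar>?S z\<bar> \<le> M * norm z powr p" for z by (rule le_mult_min1(2)[OF M(2) M(1)])
  qed measurable
  then have lim: "((\<lambda>s. (1 - s) * (\<integral>t. indicator {0<..} t * t powr (s * p / 2 - 1) * gauss_dilation ?S t \<partial>lborel)) \<longlongrightarrow> 2 / p * m) (at_left 1)"
    by (intro abelian_powr_limit[OF _ p0(2) C dil]) measurable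
  have m: "m = - ((p - 1) / 4) * (pi powr ((real CARD('n) - 1) / 2) * Gamma ((p - 1) / 2)) * p_laplacian p \<phi> x"
  proof -
    have gw: "G x \<bullet> w = norm (G x) * (e \<bullet> w)" for w
      using e(2) by (metis inner_scaleR_left)
    have "m = (\<integral>w. (- ((p - 1) / 2 * pweight p (norm (G x)))) * (exp (- ((norm w)^2)) * pweight p (e \<bullet> w) * (w \<bullet> (H x *v w))) \<partial>lborel)"
      unfolding m_def Q_def gw pweight_mult by (intro Bochner_Integration.integral_cong) auto
    also have "\<dots> = - ((p - 1) / 2 * pweight p (norm (G x))) * (\<integral>w. exp (- ((norm w)^2)) * pweight p (e \<bullet> w) * (w \<bullet> (H x *v w)) \<partial>lborel)"
      by (rule integral_mult_right_zero)
    also have "\<dots> = - ((p - 1) / 4) * (sqrt pi ^ CARD('n) / sqrt pi * Gamma ((p - 1) / 2)) * p_laplacian p \<phi> x"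
      unfolding integral_gaussian_quadratic[OF p e(1)] p_laplacian_eq[OF p e] by (simp add: mult_ac)
    also have "sqrt pi ^ CARD('n) / sqrt pi = pi powr ((real CARD('n) - 1) / 2)"
    proof -
      have "sqrt pi ^ CARD('n) = pi powr (real CARD('n) / 2)"
        by (simp add: powr_half_sqrt[symmetric] powr_powr flip: powr_realpow)
      then show ?thesis by (simp add: powr_half_sqrt[symmetric] diff_divide_distrib powr_diff)
    qed
    finally show ?thesis .
  qed
  define c where "c s = s * p / 2 * 2 powr (2 * s - 1) / pi powr ((real CARD('n) - 1) / 2) / (Gamma ((p + 1) / 2) * Gamma (2 - s))" for s
  have Gp: "Gamma ((p + 1) / 2) > 0" "Gamma ((p - 1) / 2) > 0" using p by auto
  have "(p - 1) / 2 \<notin> \<int>\<^sub>\<le>\<^sub>0" using p by (auto dest: nonpos_Ints_nonpos)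
  then have G1: "Gamma ((p + 1) / 2) = (p - 1) / 2 * Gamma ((p - 1) / 2)"
    using Gamma_plus1[of "(p - 1) / 2"] by (simp add: field_simps)
  have "(c \<longlongrightarrow> c 1) (at_left 1)"
    unfolding c_def by (intro tendsto_intros) (use Gp in \<open>auto dest!: nonpos_Ints_nonpos\<close>)
  then have lims: "((\<lambda>s. c s * ((1 - s) * (\<integral>t. indicator {0<..} t * t powr (s * p / 2 - 1) * gauss_dilation ?S t \<partial>lborel))) \<longlongrightarrow> c 1 * (2 / p * m)) (at_left 1)"
    by (intro tendsto_mult lim)
  have c1: "c 1 * (2 / p * m) = - p_laplacian p \<phi> x"
  proof -
    have c1: "c 1 = p / (pi powr ((real CARD('n) - 1) / 2) * ((p - 1) / 2 * Gamma ((p - 1) / 2)))"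
      unfolding c_def G1 by simp
    have cancel: "p / (X * ((p - 1) / 2 * Y)) * (2 / p * (- ((p - 1) / 4) * (X * Y) * Z)) = - Z"
      if "X > 0" "Y > 0" for X Y Z :: real
      using that p by (simp add: field_simps)
    show ?thesis unfolding m c1 by (rule cancel) (use Gp(2) in simp_all)
  qed
  have "\<forall>\<^sub>F s in at_left 1. c s * ((1 - s) * (\<integral>t. indicator {0<..} t * t powr (s * p / 2 - 1) * gauss_dilation ?S t \<partial>lborel))
      = frac_p_laplacian s p \<phi> x"
  proof -
    have "\<forall>\<^sub>F s in at_left 1. 0 < s \<and> s < (1::real)"
      using eventually_at_left_real[of 0 "1::real"] by (auto elim: eventually_mono)
    then show ?thesis
    proof eventually_elim
      case (elim s)
      show ?case
        using elim unfolding frac_p_laplacian_eq[OF p conjunct1[OF elim] conjunct2[OF elim]] C1_def c_def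
        by (subst integral_fractional_kernel[OF S p0(2) _ _ M, symmetric]) (auto simp: field_simps)
    qed
  qed
  then show ?thesis by (rule Lim_transform_eventually[OF lims[unfolded c1]])
qed

end

end

theorem lemma5p1:
  fixes \<phi> :: "real^'n \<Rightarrow> real" and x :: "real^'n"
  assumes "\<phi> \<in> C2b"
  shows "(\<forall>p::real. p \<ge> 2 \<longrightarrow>
            ((\<lambda>s. frac_p_laplacian s p \<phi> x) \<longlongrightarrow> - p_laplacian p \<phi> x) (at_left 1)) \<and>
         (\<forall>s::real. 0 < s \<and> s < 1 \<longrightarrow>
            ((\<lambda>p. frac_p_laplacian s p \<phi> x) \<longlongrightarrow> frac_laplacian s \<phi> x) (at_right 2))"
proof -
  from assms obtain G :: "real^'n \<Rightarrow> real^'n" and H :: "real^'n \<Rightarrow> real^'n^'n" where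
    GH: "\<And>y. GDERIV \<phi> y :> G y" "\<And>y. (G has_derivative (\<lambda>h. H y *v h)) (at y)"
      "bounded (range \<phi>)" "bounded (range G)" "bounded (range H)"
    unfolding C2b_def by blast
  show ?thesis
    using tendsto_frac_p_laplacian_order[OF GH] tendsto_frac_p_laplacian_exponent[OF GH] by blast
qed

end
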